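(* Let $\alpha\in[g,G]$. The measure-preserving transformation $(I_\alpha,\mathcal B_{I_\alpha},\varphi_\alpha,\nu_\alpha)$ is ergodic.
   Context: $g=\frac12(\sqrt5-1)$, $G=\frac12(\sqrt5+1)$, $[\cdot]$ in the formula for $d_\alpha$ is the integer part (floor); $\mathcal B_C$ is the Borel $\sigma$-algebra on $C$. $I_\alpha=[\alpha-2,\alpha)$. For $x\ne0$, $d_\alpha(x)=2\left[\frac1{2|x|}+\frac{1-\alpha}2\right]+1$ and $\varphi_\alpha(x)=\frac1{|x|}-d_\alpha(x)$, with $\varphi_\alpha(0)=0$; the same formulas at $x=\alpha$ define $\varphi_\alpha(\alpha)=\frac1\alpha-d_\alpha(\alpha)$. For $g<\alpha<G$, $$\Omega_\alpha=\big(I_\alpha\times[0,2-G)\big)\cup\big((\varphi_\alpha(\alpha),\alpha)\times(2-G,1]\big)\cup\big([\varphi_\alpha(\alpha-2),\alpha)\times[1,G)\big),$$ while $\Omega_g=\big([g-2,g)\times[0,1-g)\big)\cup\big([\frac{g-1}{2-g},g)\times[1,G)\big)$ and $\Omega_G=[G-2,G)\times[0,1)$. Let $d\mu_\alpha=(1+xy)^{-2}dx\,dy$ on $\Omega_\alpha$ (total mass $3\log G$), $\tilde\mu_\alpha=(3\log G)^{-1}\mu_\alpha$; the $\varphi_\alpha$-invariant probability measure $\nu_\alpha$ is $\nu_\alpha(E)=\tilde\mu_\alpha(\{(x,y)\in\Omega_\alpha:x\in E\})$, $E\in\mathcal B_{I_\alpha}$. *)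

theory Defs
  imports "HOL-Analysis.Analysis"
begin

definition small_golden :: real where
  "small_golden = (sqrt 5 - 1) / 2"

definition big_golden :: real where
  "big_golden = (sqrt 5 + 1) / 2"

definition alpha_interval :: "real \<Rightarrow> real set" where
  "alpha_interval \<alpha> = {\<alpha> - 2..<\<alpha>}"

definition odd_digit :: "real \<Rightarrow> real \<Rightarrow> int" where
  "odd_digit \<alpha> x = 2 * \<lfloor>1 / (2 * \<bar>x\<bar>) + (1 - \<alpha>) / 2\<rfloor> + 1"

text \<open>The map is defined on all reals, so that it can also be evaluated at the endpoint
  \<open>\<alpha>\<close>, which does not belong to \<open>alpha_interval \<alpha>\<close>.\<close>

definition odd_map :: "real \<Rightarrow> real \<Rightarrow> real" where
  "odd_map \<alpha> x = (if x = 0 then 0 else 1 / \<bar>x\<bar> - real_of_int (odd_digit \<alpha> x))"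

text \<open>Only parameters in \<open>{small_golden..big_golden}\<close> are meaningful; the generic formula
  is not used at the two endpoints, where it would give a different set.\<close>

definition nat_ext_domain :: "real \<Rightarrow> (real \<times> real) set" where
  "nat_ext_domain \<alpha> =
    (if \<alpha> = small_golden then
       {small_golden - 2..<small_golden} \<times> {0..<1 - small_golden} \<union>
       {(small_golden - 1) / (2 - small_golden)..<small_golden} \<times> {1..<big_golden}
     else if \<alpha> = big_golden then
       {big_golden - 2..<big_golden} \<times> {0..<1}
     else
       alpha_interval \<alpha> \<times> {0..<2 - big_golden} \<union>
       {odd_map \<alpha> \<alpha><..<\<alpha>} \<times> {2 - big_golden<..1} \<union>
       {odd_map \<alpha> (\<alpha> - 2)..<\<alpha>} \<times> {1..<big_golden})"

definition nat_ext_measure :: "real \<Rightarrow> (real \<times> real) measure" where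
  "nat_ext_measure \<alpha> =
    density (restrict_space lborel (nat_ext_domain \<alpha>))
      (\<lambda>(x, y). ennreal (1 / (1 + x * y)\<^sup>2))"

definition nat_ext_prob :: "real \<Rightarrow> (real \<times> real) measure" where
  "nat_ext_prob \<alpha> = scale_measure (ennreal (1 / (3 * ln big_golden))) (nat_ext_measure \<alpha>)"

text \<open>The push-forward along \<open>fst\<close> gives a Borel set \<open>E\<close> of \<open>alpha_interval \<alpha>\<close> the mass of
  the part of \<open>nat_ext_domain \<alpha>\<close> lying over \<open>E\<close>.\<close>

definition alpha_measure :: "real \<Rightarrow> real measure" where
  "alpha_measure \<alpha> =
    distr (nat_ext_prob \<alpha>) (restrict_space borel (alpha_interval \<alpha>)) fst"

definition measure_preserving :: "'a measure \<Rightarrow> ('a \<Rightarrow> 'a) \<Rightarrow> bool" where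
  "measure_preserving M T \<longleftrightarrow>
     T \<in> measurable M M \<and>
     (\<forall>A\<in>sets M. emeasure M (T -` A \<inter> space M) = emeasure M A)"

text \<open>Ergodicity of a measure-preserving transformation of a probability space; the system
  being of this kind is part of the notion.\<close>

definition ergodic_system :: "'a measure \<Rightarrow> ('a \<Rightarrow> 'a) \<Rightarrow> bool" where
  "ergodic_system M T \<longleftrightarrow>
     emeasure M (space M) = 1 \<and>
     measure_preserving M T \<and>
     (\<forall>A\<in>sets M. T -` A \<inter> space M = A \<longrightarrow> emeasure M A = 0 \<or> emeasure M A = 1)"

end

theory Submission
  imports Defs
begin

text \<open>
  Ergodicity. Extend an invariant set of \<open>odd_map \<alpha>\<close> to a subset \<open>S\<close> of the reals with period \<open>2\<close>.
  Invariance reads \<open>x \<in> S \<longleftrightarrow> 1 / \<bar>x\<bar> + 1 \<in> S\<close>, but only for \<open>x\<close> in \<open>alpha_interval \<alpha>\<close>. Since the orbits of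
  the two endpoints \<open>\<alpha>\<close> and \<open>\<alpha> - 2\<close> meet after two steps, this forces \<open>S\<close> to be symmetric about \<open>0\<close> and
  then \<open>x \<in> S \<longleftrightarrow> 1 / x + 1 \<in> S\<close> for every irrational \<open>x\<close>. So \<open>S\<close> is invariant under the group of
  fractional linear maps generated by \<open>x + 2\<close> and \<open>1 / x + 1\<close>, for which every rational is a
  parabolic fixed point. Near a fraction \<open>h / k\<close> the set looks like the image of a full period under
  inversion, hence has a density bounded below in the ball of radius \<open>1 / k\<^sup>2\<close>. By Dirichlet's
  approximation theorem these balls form a Vitali cover, so \<open>S\<close> is null or conull.

  Invariance of the measure. Integrating out the second coordinate gives an explicit density, and
  the density of its image under \<open>x \<mapsto> 1 / \<bar>x\<bar>\<close> telescopes along translations by \<open>2\<close>.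
\<close>

section \<open>Invariant sets and the group action on the line\<close>

lemma big_golden_sq: "big_golden\<^sup>2 = big_golden + 1"
  by (simp add: big_golden_def power2_eq_square field_simps)

lemma small_golden_eq: "small_golden = big_golden - 1"
  by (simp add: big_golden_def small_golden_def field_simps)

lemma big_golden_bounds: "8 / 5 < big_golden" "big_golden < 5 / 3"
proof -
  have "11 / 5 < sqrt 5" "sqrt 5 < 7 / 3"
    by (rule real_less_rsqrt real_less_lsqrt; simp add: power2_eq_square)+
  then show "8 / 5 < big_golden" "big_golden < 5 / 3"
    by (simp_all add: big_golden_def)
qed

text \<open>The two quadratic inequalities restate the two bounds on \<open>\<alpha>\<close>:
  \<open>small_golden\<close> and \<open>big_golden\<close> are the positive roots of x^2 + x = 1
  and x^2 = x + 1.\<close>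

lemma alpha_bounds:
  assumes "\<alpha> \<in> {small_golden..big_golden}"
  shows "3 / 5 < \<alpha>" "\<alpha> < 5 / 3" "1 \<le> \<alpha> + \<alpha>\<^sup>2" "\<alpha>\<^sup>2 \<le> \<alpha> + 1"
proof -
  show b: "3 / 5 < \<alpha>" "\<alpha> < 5 / 3"
    using assms big_golden_bounds by (auto simp: small_golden_eq)
  have "(big_golden - 1)\<^sup>2 \<le> \<alpha>\<^sup>2"
    using assms big_golden_bounds by (intro power_mono) (auto simp: small_golden_eq)
  then show "1 \<le> \<alpha> + \<alpha>\<^sup>2"
    using assms by (simp add: power2_diff big_golden_sq small_golden_eq)
  \<comment> \<open>The product equals \<open>\<alpha>\<^sup>2 - \<alpha> - 1\<close>, because
    \<open>big_golden * (big_golden - 1) = 1\<close>.\<close>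
  have "(\<alpha> - big_golden) * (\<alpha> + (big_golden - 1)) \<le> 0"
    using assms b big_golden_bounds by (intro mult_nonpos_nonneg) auto
  then show "\<alpha>\<^sup>2 \<le> \<alpha> + 1"
    using big_golden_sq by (simp add: algebra_simps power2_eq_square)
qed

section \<open>Symmetries of a 2-periodic set forced by the map\<close>

lemma periodic_int:
  fixes S :: "real set"
  assumes per: "\<And>x. x + 2 \<in> S \<longleftrightarrow> x \<in> S"
  shows "x + 2 * of_int k \<in> S \<longleftrightarrow> x \<in> S"
proof -
  have nat: "y + 2 * of_nat n \<in> S \<longleftrightarrow> y \<in> S" for y n
    using per[of "y + 2 * of_nat _"] by (induction n) (simp_all add: algebra_simps)
  show ?thesis
  proof (cases k)
    case (nonneg n)
    then show ?thesis using nat[of x n] by simp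
  next
    case (neg n)
    have "x + 2 * of_int k = x - 2 * of_nat (Suc n)" using neg by simp
    then show ?thesis using nat[of "x - 2 * of_nat (Suc n)" "Suc n"] by (metis diff_add_cancel)
  qed
qed

text \<open>Representatives of \<open>x\<close> and \<open>- x\<close> modulo 2 are followed inside
  the interval until their orbits meet, either at \<open>1 / x + 1\<close> at once or at
  \<open>1 / (1 - x)\<close> after two steps.\<close>

lemma reflection_on_unit_interval:
  fixes S :: "real set"
  assumes \<alpha>: "\<alpha> \<in> {small_golden..big_golden}"
    and per: "\<And>x. x + 2 \<in> S \<longleftrightarrow> x \<in> S"
    and K: "\<And>x. x \<in> alpha_interval \<alpha> \<Longrightarrow> x \<noteq> 0 \<Longrightarrow> x \<in> S \<longleftrightarrow> 1 / \<bar>x\<bar> + 1 \<in> S"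
    and x: "0 < x" "x < 1"
  shows "(- x \<in> S \<longleftrightarrow> x \<in> S) \<and> (x \<in> S \<longleftrightarrow> 1 / x + 1 \<in> S)"
proof -
  note b = alpha_bounds[OF \<alpha>]
  have per': "x \<in> S \<longleftrightarrow> y \<in> S" if "y = x + 2 * of_int k" for x y k
    using periodic_int[of S, OF per] that by blast
  have pos: "y \<in> S \<longleftrightarrow> 1 / y + 1 \<in> S" if "0 < y" "y < \<alpha>" for y
    using K[of y] that b by (auto simp: alpha_interval_def)
  have neg: "- y \<in> S \<longleftrightarrow> 1 / y + 1 \<in> S" if "0 < y" "y \<le> 2 - \<alpha>" for y
    using K[of "- y"] that b by (auto simp: alpha_interval_def)
  \<comment> \<open>In the first case \<open>x\<close> and \<open>- x\<close> both lie in the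
    interval and share the image \<open>1 / x + 1\<close>. In the second \<open>x\<close> must be
    replaced by \<open>x - 2\<close>, in the third \<open>- x\<close> by
    \<open>2 - x\<close>.\<close>
  consider "x < \<alpha>" "x \<le> 2 - \<alpha>" | "\<alpha> \<le> x" | "2 - \<alpha> < x" by linarith
  then show ?thesis
  proof cases
    case 1
    then show ?thesis using pos[of x] neg[of x] x by auto
  next
    case 2
    \<comment> \<open>\<open>- y\<close> is \<open>1 / (2 - x) + 1\<close> moved back by one period,
      the first orbit point of \<open>x - 2\<close>; its own image is \<open>1 / (1 - x)\<close> up
      to a period.\<close>
    define y where "y = (1 - x) / (2 - x)"
    have y: "0 < y" "y < \<alpha>" "y \<le> 2 - \<alpha>"
    proof -
      show "0 < y" using x by (simp add: y_def)
      have "y < 2 / 5" using x b 2 by (simp add: y_def field_simps)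
      then show "y < \<alpha>" "y \<le> 2 - \<alpha>" using b x 2 by auto
    qed
    have "x \<in> S \<longleftrightarrow> x - 2 \<in> S" by (rule per'[of _ _ "-1"]) simp
    also have "\<dots> \<longleftrightarrow> 1 / (2 - x) + 1 \<in> S" using neg[of "2 - x"] x 2 by auto
    also have "\<dots> \<longleftrightarrow> - y \<in> S"
      using x by (intro per'[of _ _ "-1"]) (simp add: y_def field_simps)
    also have "\<dots> \<longleftrightarrow> 1 / y + 1 \<in> S" using neg[of y] y by simp
    also have "\<dots> \<longleftrightarrow> 1 / (1 - x) \<in> S"
      using x by (intro per'[of _ _ "-1"]) (simp add: y_def field_simps)
    finally have A: "x \<in> S \<longleftrightarrow> 1 / (1 - x) \<in> S" .
    have B: "- x \<in> S \<longleftrightarrow> 1 / x + 1 \<in> S" using neg[of x] x 2 b by auto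
    have C: "1 / x + 1 \<in> S \<longleftrightarrow> 1 / x - 1 \<in> S"
      by (rule per'[of _ _ "-1"]) simp
    show ?thesis
    proof (cases "1 / x - 1 < \<alpha>")
      case True
      \<comment> \<open>The orbit of \<open>- x\<close> passes through \<open>1 / x - 1\<close> and
        now also arrives at \<open>1 / (1 - x)\<close>.\<close>
      have "1 / x - 1 \<in> S \<longleftrightarrow> 1 / (1 / x - 1) + 1 \<in> S"
        using True x by (intro pos) (auto simp: field_simps)
      also have "1 / (1 / x - 1) + 1 = 1 / (1 - x)" using x by (simp add: field_simps)
      finally show ?thesis using A B C by simp
    next
      case False
      \<comment> \<open>Only possible for \<open>x = \<alpha> = small_golden\<close>, the fixed point of \<open>1 / x - 1\<close>.\<close>
      have "\<alpha> * x \<le> 1 - x" using False x by (simp add: field_simps)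
      moreover have "\<alpha>\<^sup>2 \<le> \<alpha> * x" using 2 b by (simp add: power2_eq_square)
      ultimately have "x = \<alpha>" "\<alpha> * x = 1 - x" using b 2 by auto
      then have "1 / x - 1 = x" using x by (simp add: field_simps)
      then show ?thesis using B C by simp
    qed
  next
    case 3
    define y where "y = (1 - x) / (2 - x)"
    have y: "0 < y" "y < \<alpha>" "y \<le> 2 - \<alpha>"
    proof -
      show "0 < y" using x by (simp add: y_def)
      have "y < 1" using x by (simp add: y_def)
      then show "y < \<alpha>" using x 3 by auto
      \<comment> \<open>\<open>y = 1 - 1 / (2 - x)\<close> decreases in \<open>x\<close>. Its value
        \<open>(\<alpha> - 1) / \<alpha>\<close> at \<open>x = 2 - \<alpha>\<close> is at most
        \<open>2 - \<alpha>\<close> because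
        \<open>\<alpha>\<^sup>2 \<le> \<alpha> + 1\<close>.\<close>
      have "(1 - x) * \<alpha> \<le> (\<alpha> - 1) * (2 - x)" using 3 by (simp add: algebra_simps)
      then have "y \<le> (\<alpha> - 1) / \<alpha>" using x b by (simp add: y_def field_simps)
      also have "\<dots> \<le> 2 - \<alpha>" using b by (simp add: field_simps power2_eq_square)
      finally show "y \<le> 2 - \<alpha>" .
    qed
    have "- x \<in> S \<longleftrightarrow> 2 - x \<in> S" by (rule per'[of _ _ 1]) simp
    also have "\<dots> \<longleftrightarrow> 1 / (2 - x) + 1 \<in> S" using pos[of "2 - x"] x 3 by auto
    also have "\<dots> \<longleftrightarrow> - y \<in> S"
      using x by (intro per'[of _ _ "-1"]) (simp add: y_def field_simps)
    also have "\<dots> \<longleftrightarrow> 1 / y + 1 \<in> S" using neg[of y] y by simp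
    also have "\<dots> \<longleftrightarrow> 1 / (1 - x) \<in> S"
      using x by (intro per'[of _ _ "-1"]) (simp add: y_def field_simps)
    finally have A: "- x \<in> S \<longleftrightarrow> 1 / (1 - x) \<in> S" .
    show ?thesis
    proof (cases "x < \<alpha>")
      case True
      have B: "x \<in> S \<longleftrightarrow> 1 / x + 1 \<in> S" using pos[of x] x True by auto
      have C: "1 / x + 1 \<in> S \<longleftrightarrow> 1 / x - 1 \<in> S"
        by (rule per'[of _ _ "-1"]) simp
      have "1 / x - 1 < \<alpha>"
      proof -
        have "1 \<le> (\<alpha> + 1) * (2 - \<alpha>)" using b by (simp add: algebra_simps power2_eq_square)
        also have "\<dots> < (\<alpha> + 1) * x" using 3 b by (intro mult_strict_left_mono) auto
        finally show ?thesis using x by (simp add: field_simps)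
      qed
      then have "1 / x - 1 \<in> S \<longleftrightarrow> 1 / (1 / x - 1) + 1 \<in> S"
        using x by (intro pos) (auto simp: field_simps)
      also have "1 / (1 / x - 1) + 1 = 1 / (1 - x)" using x by (simp add: field_simps)
      finally show ?thesis using A B C by simp
    next
      case False
      then show ?thesis using 3 x by linarith
    qed
  qed
qed

lemma reflection_invariant:
  fixes S :: "real set"
  assumes per: "\<And>x. x + 2 \<in> S \<longleftrightarrow> x \<in> S"
    and refl: "\<And>x. x \<notin> \<rat> \<Longrightarrow> 0 < x \<Longrightarrow> x < 1 \<Longrightarrow> - x \<in> S \<longleftrightarrow> x \<in> S"
    and x: "x \<notin> \<rat>"
  shows "- x \<in> S \<longleftrightarrow> x \<in> S"
proof -
  define k y where "k = \<lfloor>(x + 1) / 2\<rfloor>" and "y = x - 2 * of_int k"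
  have y: "y \<notin> \<rat>" using x Rats_add[of y "2 * of_int k"] by (auto simp: y_def)
  then have ne: "y \<noteq> 0" "y \<noteq> 1" "y \<noteq> -1" by auto
  have "-1 \<le> y" "y < 1" using floor_correct[of "(x + 1) / 2"] by (simp_all add: y_def k_def field_simps)
  then have "- y \<in> S \<longleftrightarrow> y \<in> S"
    using refl[of y] refl[of "- y"] y ne by (cases "0 < y") (auto simp: Rats_minus_iff)
  moreover have "- y = - x + 2 * of_int k" "y = x + 2 * of_int (- k)"
    by (simp_all add: y_def)
  ultimately show ?thesis using periodic_int[of S, OF per] by metis
qed

text \<open>What is missing is \<open>x > 1\<close>. With \<open>v = 1 / x\<close> in the unit
  interval this is the equivalence of \<open>1 + v\<close> and \<open>1 / v\<close>, and negative
  \<open>x\<close> follow by reflection.\<close>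

lemma inversion_invariant:
  fixes S :: "real set"
  assumes per: "\<And>x. x + 2 \<in> S \<longleftrightarrow> x \<in> S"
    and refl: "\<And>x. x \<notin> \<rat> \<Longrightarrow> - x \<in> S \<longleftrightarrow> x \<in> S"
    and inv: "\<And>x. x \<notin> \<rat> \<Longrightarrow> 0 < x \<Longrightarrow> x < 1 \<Longrightarrow> x \<in> S \<longleftrightarrow> 1 / x + 1 \<in> S"
    and x: "x \<notin> \<rat>"
  shows "x \<in> S \<longleftrightarrow> 1 / x + 1 \<in> S"
proof -
  let ?g = "big_golden - 1"
  have irr: "1 / y \<notin> \<rat>" "1 / y - 1 \<notin> \<rat>" "1 / y + 1 \<notin> \<rat>" "1 - y \<notin> \<rat>" "1 + y \<notin> \<rat>" "- y \<notin> \<rat>"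
    "y - 1 \<notin> \<rat>"
    if "y \<notin> \<rat>" for y :: real
  proof -
    show 1: "1 / y \<notin> \<rat>" using that Rats_divide[of 1 "1 / y"] by auto
    then show "1 / y - 1 \<notin> \<rat>" "1 / y + 1 \<notin> \<rat>"
      using Rats_add[of "1 / y - 1" 1] Rats_diff[of "1 / y + 1" 1] by auto
    show "1 - y \<notin> \<rat>" "1 + y \<notin> \<rat>" "- y \<notin> \<rat>" "y - 1 \<notin> \<rat>" using that Rats_diff[of 1 "1 - y"]
      Rats_diff[of "1 + y" 1] Rats_add[of "y - 1" 1] by (auto simp: Rats_minus_iff)
  qed
  \<comment> \<open>The map \<open>v \<mapsto> 1 / v - 1\<close> expands away from its fixed point, so every other point of the
     unit interval eventually reaches \<open>{0<..<1/2}\<close>, where the claim is immediate.\<close>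
  have step: "1 + v \<in> S \<longleftrightarrow> 1 / v \<in> S"
    if "1 \<le> \<bar>v - ?g\<bar> * (8 / 5) ^ n" "v \<notin> \<rat>" "0 < v" "v < 1" for v n
    using that
  proof (induction n arbitrary: v)
    \<comment> \<open>Vacuous: \<open>v\<close> and \<open>?g\<close> both lie in the open unit
      interval, so their distance is less than 1.\<close>
    case 0
    then show ?case using big_golden_bounds by auto
  next
    case (Suc n)
    \<comment> \<open>Subtracting a period and reflecting brings \<open>1 + v\<close> to
      \<open>1 - v\<close>, where inversion is known.\<close>
    have "1 + v \<in> S \<longleftrightarrow> - (1 - v) \<in> S" using per[of "v - 1"] by (simp add: algebra_simps)
    also have "\<dots> \<longleftrightarrow> 1 / (1 - v) + 1 \<in> S"
      using refl[of "1 - v"] inv[of "1 - v"] irr Suc.prems by simp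
    also have "\<dots> \<longleftrightarrow> 1 / (1 - v) - 1 \<in> S"
      using per[of "1 / (1 - v) - 1"] by (simp add: algebra_simps)
    also have "1 / (1 - v) - 1 = v / (1 - v)" using Suc.prems by (simp add: field_simps)
    finally have A: "1 + v \<in> S \<longleftrightarrow> v / (1 - v) \<in> S" .
    have "v \<noteq> 1 / 2" using Suc.prems(2) by (metis Rats_divide Rats_1 Rats_number_of)
    then consider "v < 1 / 2" | "1 / 2 < v" by linarith
    then show ?case
    proof cases
      case 1
      have "v / (1 - v) \<notin> \<rat>"
        using irr(1)[OF irr(2)[OF Suc.prems(2)]] Suc.prems by (simp add: field_simps)
      moreover have "0 < v / (1 - v)" "v / (1 - v) < 1"
        using Suc.prems 1 by (simp_all add: field_simps)
      ultimately have "v / (1 - v) \<in> S \<longleftrightarrow> 1 / (v / (1 - v)) + 1 \<in> S" by (rule inv)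
      also have "1 / (v / (1 - v)) + 1 = 1 / v" using Suc.prems by (simp add: field_simps)
      finally show ?thesis using A by simp
    next
      case 2
      \<comment> \<open>Since \<open>v / (1 - v) = 1 / w\<close> and \<open>1 + w = 1 / v\<close>,
        the claim for \<open>v\<close> is the claim for \<open>w\<close> with its sides
        exchanged.\<close>
      define w where "w = 1 / v - 1"
      have w: "w \<notin> \<rat>" "0 < w" "w < 1"
        using irr(2)[OF Suc.prems(2)] Suc.prems 2 by (auto simp: w_def field_simps)
      \<comment> \<open>This identity turns \<open>1 / v - big_golden\<close> into a multiple of
        \<open>?g - v\<close>, which exhibits the expansion factor
        \<open>big_golden / v\<close>.\<close>
      have gg: "1 = ?g * big_golden"
        using big_golden_sq by (simp add: algebra_simps power2_eq_square)
      have "w - ?g = (?g - v) * big_golden / v"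
        using gg Suc.prems by (simp add: w_def field_simps)
      then have "\<bar>w - ?g\<bar> = \<bar>v - ?g\<bar> * (big_golden / v)"
        using Suc.prems big_golden_bounds by (simp add: abs_mult abs_minus_commute)
      moreover have "8 / 5 \<le> big_golden / v"
        using Suc.prems big_golden_bounds by (simp add: field_simps)
      ultimately have "\<bar>v - ?g\<bar> * (8 / 5) \<le> \<bar>w - ?g\<bar>"
        by (metis abs_ge_zero mult_left_mono)
      then have "\<bar>v - ?g\<bar> * (8 / 5) * (8 / 5) ^ n \<le> \<bar>w - ?g\<bar> * (8 / 5) ^ n"
        by (rule mult_right_mono) simp
      moreover have "1 \<le> \<bar>v - ?g\<bar> * (8 / 5) * (8 / 5) ^ n" using Suc.prems(1) by simp
      ultimately have "1 \<le> \<bar>w - ?g\<bar> * (8 / 5) ^ n" by linarith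
      then have "1 + w \<in> S \<longleftrightarrow> 1 / w \<in> S" using w by (rule Suc.IH)
      then show ?thesis
        using A Suc.prems by (simp add: w_def field_simps)
    qed
  qed
  have unit: "1 + v \<in> S \<longleftrightarrow> 1 / v \<in> S" if v: "v \<notin> \<rat>" "0 < v" "v < 1" for v
  proof (cases "v = ?g")
    case True
    \<comment> \<open>At the fixed point \<open>1 + v\<close> and \<open>1 / v\<close> are the same
      number.\<close>
    have "1 / ?g = big_golden"
      using big_golden_sq big_golden_bounds by (simp add: field_simps power2_eq_square)
    then show ?thesis using True by simp
  next
    case False
    obtain n where "1 / \<bar>v - ?g\<bar> < (8 / 5) ^ n"
      using real_arch_pow[of "8 / 5"] by auto
    then have "1 \<le> \<bar>v - ?g\<bar> * (8 / 5) ^ n" using False by (simp add: field_simps)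
    then show ?thesis using v by (rule step)
  qed
  have pos: "y \<in> S \<longleftrightarrow> 1 / y + 1 \<in> S" if "y \<notin> \<rat>" "0 < y" for y
  proof (cases "y < 1")
    case False
    then have "1 < y" using that by (cases "y = 1") auto
    then show ?thesis using unit[of "1 / y"] irr that by (simp add: add.commute)
  qed (use inv that in auto)
  show ?thesis
  proof (cases "0 < x")
    case False
    then have "x < 0" using x by (cases "x = 0") auto
    have "x \<in> S \<longleftrightarrow> 1 / (- x) + 1 \<in> S" using pos[of "- x"] refl irr x \<open>x < 0\<close> by auto
    also have "\<dots> \<longleftrightarrow> 1 / x - 1 \<in> S" using refl[of "1 / x - 1"] irr x by (simp add: add.commute)
    also have "\<dots> \<longleftrightarrow> 1 / x + 1 \<in> S" using per[of "1 / x - 1"] by (simp add: algebra_simps)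
    finally show ?thesis .
  qed (use pos x in auto)
qed

section \<open>The set near a rational point\<close>

text \<open>A group element of determinant 1 or -1 carries infinity to \<open>p / q\<close>; in the
  coordinate \<open>z\<close> it transports the 2-periodicity at infinity to the cusp. It is built
  by a Euclidean algorithm: \<open>p\<close> is reduced modulo \<open>2 * q\<close>, then
  \<open>x \<mapsto> 1 / x + 1\<close> makes the numerator the new denominator.\<close>

lemma cusp_neighbourhood:
  fixes S :: "real set" and p q :: int
  assumes per: "\<And>x. x + 2 \<in> S \<longleftrightarrow> x \<in> S"
    and inv: "\<And>x. x \<notin> \<rat> \<Longrightarrow> x \<in> S \<longleftrightarrow> 1 / x + 1 \<in> S"
    and "coprime p q" "q \<noteq> 0"
  shows "\<exists>\<delta>\<in>\<rat>. \<exists>s\<in>{1, -1}. \<forall>z. z \<notin> \<rat> \<longrightarrow>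
           (of_int p / of_int q + s / ((of_int q)\<^sup>2 * z) \<in> S \<longleftrightarrow> z + \<delta> \<in> S)"
  using \<open>coprime p q\<close> \<open>q \<noteq> 0\<close>
proof (induction "nat \<bar>q\<bar>" arbitrary: p q rule: less_induct)
  case less
  note perk = periodic_int[of S, OF per]
  \<comment> \<open>Only translations by even integers are available, so \<open>p\<close> is reduced
    modulo \<open>2 * \<bar>q\<bar>\<close> to a remainder in
    \<open>{- \<bar>q\<bar>..<\<bar>q\<bar>}\<close>. Hence
    \<open>\<bar>p'\<bar> = \<bar>q\<bar>\<close> can occur and needs its own case.\<close>
  define k where "k = (p + \<bar>q\<bar>) div (2 * \<bar>q\<bar>)"
  define p' where "p' = p - 2 * q * (sgn q * k)"
  have p'k: "p' = p - 2 * \<bar>q\<bar> * k" by (simp add: p'_def abs_sgn mult.commute mult.left_commute)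
  have "p' = (p + \<bar>q\<bar>) mod (2 * \<bar>q\<bar>) - \<bar>q\<bar>"
    by (simp add: p'k k_def minus_mult_div_eq_mod[symmetric])
  moreover have "0 \<le> (p + \<bar>q\<bar>) mod (2 * \<bar>q\<bar>)" "(p + \<bar>q\<bar>) mod (2 * \<bar>q\<bar>) < 2 * \<bar>q\<bar>"
    using less.prems by (auto intro: pos_mod_sign pos_mod_bound)
  ultimately have abs_p': "\<bar>p'\<bar> \<le> \<bar>q\<bar>" by linarith
  have cop: "coprime p' q"
    using less.prems gcd_add_mult[of q "2 * (sgn q * k)" p']
    by (simp add: p'_def coprime_iff_gcd_eq_1 gcd.commute algebra_simps)
  have frac: "of_int p / of_int q = of_int p' / of_int q + 2 * real_of_int (sgn q * k)"
    using less.prems by (simp add: p'_def field_simps)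
  have red: "of_int p / of_int q + y \<in> S \<longleftrightarrow> of_int p' / of_int q + y \<in> S" for y :: real
    using perk[of "of_int p' / of_int q + y" "sgn q * k"] by (simp add: frac algebra_simps)
  show ?case
  proof (cases "p' = 0")
    \<comment> \<open>The cusp is an even integer, and a single inversion moves it to
      infinity.\<close>
    case True
    then have "\<bar>q\<bar> = 1" using cop by simp
    then have q2: "(real_of_int q)\<^sup>2 = 1" by (metis of_int_1 of_int_abs power2_abs power_one)
    have "1 / z \<in> S \<longleftrightarrow> z + 1 \<in> S" if "z \<notin> \<rat>" for z
      using inv[of "1 / z"] that Rats_divide[of 1 "1 / z"] by auto
    then show ?thesis
      using red True q2 by - (rule bexI[of _ 1], rule bexI[of _ 1], auto)
  next
    case p'0: False
    show ?thesis
    proof (cases "\<bar>p'\<bar> < \<bar>q\<bar>")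
      case True
      \<comment> \<open>\<open>x \<mapsto> 1 / x + 1\<close> sends \<open>p' / q\<close> to
        \<open>(p' + q) / p'\<close>, whose denominator is smaller in absolute value.\<close>
      have "coprime (p' + q) p'" using cop
        by (metis add.commute coprime_commute coprime_iff_gcd_eq_1 gcd_add1)
      with True p'0 less.hyps[of p' "p' + q"] obtain \<delta> s where
        d: "\<delta> \<in> \<rat>" "s \<in> {1, -1}" and
        *: "\<And>z. z \<notin> \<rat> \<Longrightarrow> of_int (p' + q) / of_int p' + s / ((of_int p')\<^sup>2 * z) \<in> S \<longleftrightarrow> z + \<delta> \<in> S"
        by fastforce
      \<comment> \<open>The value is forced by factoring \<open>p' / q - s / (q\<^sup>2 * z)\<close>
        as \<open>p' * (z + t) / (q * z)\<close>: inversion shifts the local coordinate by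
        \<open>t\<close> and reverses the sign \<open>s\<close>. As \<open>t\<close> is rational,
        \<open>z + t\<close> stays irrational.\<close>
      define t where "t = (- s) / (of_int p' * of_int q)"
      have t: "t \<in> \<rat>" using d by (auto simp: t_def)
      have "of_int p' / of_int q + (- s) / ((of_int q)\<^sup>2 * z) \<in> S \<longleftrightarrow> z + (t + \<delta>) \<in> S" if z: "z \<notin> \<rat>" for z
      proof -
        define w where "w = of_int p' / of_int q + (- s) / ((of_int q)\<^sup>2 * z)"
        have z0: "z \<noteq> 0" using z by auto
        have zt: "z + t \<notin> \<rat>" using z t Rats_diff[of "z + t" t] by auto
        then have zt0: "z + t \<noteq> 0" by auto
        have w: "w = of_int p' * (z + t) / (of_int q * z)"
          using p'0 less.prems z0 by (simp add: w_def t_def field_simps power2_eq_square)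
        have "w \<notin> \<rat>"
        proof
          assume "w \<in> \<rat>"
          then have "(- s) / ((w - of_int p' / of_int q) * (of_int q)\<^sup>2) \<in> \<rat>"
            using d by (auto intro!: Rats_divide Rats_mult Rats_diff)
          moreover have "(- s) / ((w - of_int p' / of_int q) * (of_int q)\<^sup>2) = z"
            using z0 less.prems d by (auto simp: w_def field_simps)
          ultimately show False using z by metis
        qed
        then have "w \<in> S \<longleftrightarrow> 1 / w + 1 \<in> S" by (rule inv)
        also have "1 / w + 1 = of_int (p' + q) / of_int p' + s / ((of_int p')\<^sup>2 * (z + t))"
        proof -
          have "1 / w = of_int q * z / (of_int p' * (z + t))" by (simp add: w)
          also have "\<dots> = of_int q / of_int p' + s / ((of_int p')\<^sup>2 * (z + t))"
            using p'0 less.prems zt0 by (simp add: t_def divide_simps power2_eq_square) (simp add: algebra_simps)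
          finally show ?thesis using p'0 by (simp add: add_divide_distrib)
        qed
        also have "\<dots> \<in> S \<longleftrightarrow> z + t + \<delta> \<in> S" using zt by (rule *)
        finally show ?thesis by (simp add: w_def add.assoc)
      qed
      then show ?thesis using d t
        by - (rule bexI[of _ "t + \<delta>"], rule bexI[of _ "- s"], simp only: red, auto)
    next
      case False
      then have "\<bar>p'\<bar> = \<bar>q\<bar>" using abs_p' by simp
      then have "q dvd p'" by (metis abs_dvd_iff dvd_abs_iff dvd_refl)
      then have "q dvd 1" using cop by (metis coprime_common_divisor dvd_refl)
      then have q1: "\<bar>q\<bar> = 1" by (simp add: zdvd1_eq)
      then have q2: "(real_of_int q)\<^sup>2 = 1" by (metis of_int_1 of_int_abs power2_abs power_one)
      have "p' = q \<or> p' = - q" using \<open>\<bar>p'\<bar> = \<bar>q\<bar>\<close> by linarith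
      \<comment> \<open>The cusp is an odd integer, which \<open>x \<mapsto> 1 / x + 1\<close> links
        to infinity directly, with no shift.\<close>
      then have "of_int p' / of_int q + y \<in> S \<longleftrightarrow> y + 1 \<in> S" for y :: real
        using less.prems per[of "y - 1"] by (auto simp: algebra_simps)
      then show ?thesis
        using red q2 inv by - (rule bexI[of _ 0], rule bexI[of _ 1], auto)
    qed
  qed
qed

section \<open>Ergodicity of the group action\<close>

text \<open>The half-line is exhausted by compact intervals that reciprocation maps onto themselves;
  on each of them smooth substitution applies.\<close>

lemma nn_integral_reciprocal:
  fixes f :: "real \<Rightarrow> ennreal"
  assumes [measurable]: "f \<in> borel_measurable borel"
  shows "(\<integral>\<^sup>+x. f x * indicator {0<..} x \<partial>lborel) =
    (\<integral>\<^sup>+z. f (1 / z) * ennreal (1 / z\<^sup>2) * indicator {0<..} z \<partial>lborel)"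
proof -
  \<comment> \<open>The offset 2 keeps the interval nondegenerate at \<open>n = 0\<close>.\<close>
  define A :: "nat \<Rightarrow> real set" where "A n = {1 / real (n + 2)..real (n + 2)}" for n
  define g where "g = (\<lambda>z. f (1 / z) * ennreal (1 / z\<^sup>2))"
  have [measurable]: "g \<in> borel_measurable borel" by (simp add: g_def)
  have A_meas [measurable]: "A n \<in> sets borel" for n by (simp add: A_def)
  have part: "emeasure (density lborel f) (A n) = emeasure (density lborel g) (A n)" for n
  proof -
    let ?a = "1 / real (n + 2)" and ?b = "real (n + 2)"
    have "?a < 1" "1 < ?b" by simp_all
    then have "?a < ?b" by (rule less_trans)
    \<comment> \<open>Substitution is applied to an increasing map, so the variable is first negated
      and \<open>z \<mapsto> - 1 / z\<close> is used in place of the reciprocal.\<close>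
    have "(\<integral>\<^sup>+x. f x * indicator (A n) x \<partial>lborel)
        = (\<integral>\<^sup>+x. f (- x) * indicator {- ?b.. - ?a} x \<partial>lborel)"
      by (subst nn_integral_real_affine[of _ "-1" 0])
        (auto simp: A_def indicator_def intro!: nn_integral_cong)
    also have "{- ?b.. - ?a} = {- 1 / ?a.. - 1 / ?b}" by simp
    also have "(\<integral>\<^sup>+x. f (- x) * indicator {- 1 / ?a.. - 1 / ?b} x \<partial>lborel)
        = (\<integral>\<^sup>+z. f (- (- 1 / z)) * ennreal (1 / z\<^sup>2) * indicator {?a..?b} z \<partial>lborel)"
    proof (rule nn_integral_substitution_aux)
      show "((\<lambda>z. - 1 / z) has_real_derivative 1 / z\<^sup>2) (at z)" if "z \<in> {?a..?b}" for z
      proof -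
        have "0 < ?a" by simp
        then have "z \<noteq> 0" using that by (metis atLeastAtMost_iff not_le)
        then show ?thesis by (auto intro!: derivative_eq_intros simp: power2_eq_square)
      qed
      show "continuous_on {?a..?b} (\<lambda>z. 1 / z\<^sup>2)"
      proof -
        have "0 < ?a" by simp
        then have "z \<noteq> 0" if "z \<in> {?a..?b}" for z using that by (metis atLeastAtMost_iff not_le)
        then show ?thesis by (auto intro!: continuous_intros)
      qed
      show "?a < ?b" by fact
    qed auto
    finally show ?thesis
      by (simp add: emeasure_density g_def A_def)
  qed
  have "incseq A"
    by (rule incseq_SucI) (simp add: A_def frac_le)
  have "(\<Union>n. A n) = {0<..}"
  proof (intro equalityI subsetI)
    fix x assume "x \<in> (\<Union>n. A n)"
    then obtain n where "1 / real (n + 2) \<le> x" by (auto simp: A_def)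
    moreover have "0 < 1 / real (n + 2)" by simp
    ultimately show "x \<in> {0<..}" by (metis greaterThan_iff less_le_trans)
  next
    fix x :: real assume x: "x \<in> {0<..}"
    obtain n where "max x (1 / x) < real n" using reals_Archimedean2 by blast
    then have "x \<in> A n" using x by (auto simp: A_def field_simps)
    then show "x \<in> (\<Union>n. A n)" by blast
  qed
  then have "emeasure (density lborel f) {0<..} = emeasure (density lborel g) {0<..}"
    using SUP_emeasure_incseq[of A "density lborel f"] SUP_emeasure_incseq[of A "density lborel g"]
      \<open>incseq A\<close> part A_meas by (auto simp: image_subset_iff)
  then show ?thesis by (simp add: emeasure_density g_def)
qed

lemma emeasure_lborel_translate:
  assumes [measurable]: "A \<in> sets borel"
  shows "emeasure lborel {x. x + t \<in> A} = emeasure lborel (A :: real set)"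
proof -
  have [measurable]: "{x. x + t \<in> A} \<in> sets borel"
    by measurable
  have "emeasure lborel A = (\<integral>\<^sup>+x. indicator A x \<partial>lborel)" by simp
  also have "\<dots> = (\<integral>\<^sup>+x. indicator A (t + 1 * x) \<partial>lborel)"
    by (subst nn_integral_real_affine[of _ 1 t]) simp_all
  also have "\<dots> = (\<integral>\<^sup>+x. indicator {x. x + t \<in> A} x \<partial>lborel)"
    by (intro nn_integral_cong) (simp add: indicator_def add.commute)
  also have "\<dots> = emeasure lborel {x. x + t \<in> A}" by simp
  finally show ?thesis by simp
qed

section \<open>Measure of 2-periodic sets in periods and in cusp balls\<close>

context
  fixes S :: "real set"
  assumes S [measurable]: "S \<in> sets borel"
    and per: "\<And>x. x + 2 \<in> S \<longleftrightarrow> x \<in> S"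
begin

lemma emeasure_periodic_shift:
  "emeasure lborel (S \<inter> {a + 2 * of_int k..<b + 2 * of_int k}) = emeasure lborel (S \<inter> {a..<b})"
proof -
  have "{x. x + 2 * of_int k \<in> S \<inter> {a + 2 * of_int k..<b + 2 * of_int k}} = S \<inter> {a..<b}"
    using periodic_int[of S, OF per] by auto
  then show ?thesis
    using emeasure_lborel_translate[of "S \<inter> {a + 2 * of_int k..<b + 2 * of_int k}" "2 * of_int k"] by simp
qed

lemma emeasure_period:
  "emeasure lborel (S \<inter> {a..<a + 2}) = emeasure lborel (S \<inter> {0..<2})"
proof -
  define k where "k = \<lfloor>a / 2\<rfloor>"
  \<comment> \<open>\<open>m\<close> is the largest even integer not exceeding \<open>a\<close>; the
    part of the window beyond \<open>m + 2\<close> is moved back by one period.\<close>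
  define m where "m = 2 * real_of_int k"
  have m: "m \<le> a" "a < m + 2"
    using floor_correct[of "a / 2"] by (simp_all add: m_def k_def field_simps)
  have "emeasure lborel (S \<inter> {a..<a + 2})
      = emeasure lborel (S \<inter> {a..<m + 2}) + emeasure lborel (S \<inter> {m + 2..<a + 2})"
    using m by (subst plus_emeasure) (auto intro!: arg_cong[where f = "emeasure lborel"])
  also have "emeasure lborel (S \<inter> {m + 2..<a + 2}) = emeasure lborel (S \<inter> {m..<a})"
    using emeasure_periodic_shift[of m 1 a] by simp
  also have "emeasure lborel (S \<inter> {a..<m + 2}) + \<dots> = emeasure lborel (S \<inter> {m..<m + 2})"
    using m by (subst plus_emeasure) (auto intro!: arg_cong[where f = "emeasure lborel"])
  also have "\<dots> = emeasure lborel (S \<inter> {0..<2})"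
    using emeasure_periodic_shift[of 0 k 2] by (simp add: m_def add.commute)
  finally show ?thesis .
qed

lemma periodic_null:
  assumes "emeasure lborel (S \<inter> {0..<2}) = 0"
  shows "S \<in> null_sets lborel"
proof -
  have "S = (\<Union>k::int. S \<inter> {2 * of_int k..<2 * of_int k + 2})"
  proof (intro equalityI subsetI)
    fix x assume "x \<in> S"
    have "x \<in> {2 * of_int \<lfloor>x / 2\<rfloor>..<2 * of_int \<lfloor>x / 2\<rfloor> + 2}"
      using floor_correct[of "x / 2"] by (simp add: field_simps)
    then show "x \<in> (\<Union>k::int. S \<inter> {2 * of_int k..<2 * of_int k + 2})" using \<open>x \<in> S\<close> by blast
  qed blast
  also have "\<dots> \<in> null_sets lborel"
    using assms emeasure_period by (intro null_sets_UN) (auto simp: null_sets_def)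
  finally show ?thesis .
qed

text \<open>The map \<open>z \<mapsto> t + s * r / z\<close> sends \<open>{1<..<3}\<close> into one
  side of the ball and scales lengths by \<open>r / z\<^sup>2\<close>, at least
  \<open>r / 9\<close>. On an interval of length 2 the translated set has the mass of a full
  period.\<close>

lemma emeasure_cusp_ball:
  assumes s: "s \<in> {1, -1}" and r: "0 < r"
    and cusp: "\<And>z. z \<notin> \<rat> \<Longrightarrow> t + s * r / z \<in> S \<longleftrightarrow> z + \<delta> \<in> S"
  shows "ennreal (r / 9) * emeasure lborel (S \<inter> {0..<2}) \<le> emeasure lborel (S \<inter> ball t r)"
proof -
  have irr: "AE z in lborel. (z::real) \<notin> \<rat>"
    using countable_imp_null_set_lborel[OF countable_rat] by (rule AE_not_in)
  let ?f = "\<lambda>x. indicator (S \<inter> ball t r) (t + s * r * x) :: ennreal"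
  have "emeasure lborel (S \<inter> {0..<2}) = emeasure lborel (S \<inter> {1 + \<delta>..<1 + \<delta> + 2})"
    by (rule emeasure_period[symmetric])
  also have "\<dots> = emeasure lborel {z. z + \<delta> \<in> S \<inter> {1 + \<delta>..<1 + \<delta> + 2}}"
    by (rule emeasure_lborel_translate[symmetric]) simp
  also have "{z. z + \<delta> \<in> S \<inter> {1 + \<delta>..<1 + \<delta> + 2}} = {z. z + \<delta> \<in> S} \<inter> {1..<3}" by auto
  finally have "ennreal (r / 9) * emeasure lborel (S \<inter> {0..<2})
      = ennreal r * (ennreal (1 / 9) * emeasure lborel ({z. z + \<delta> \<in> S} \<inter> {1..<3}))"
    using r by (simp add: mult.assoc[symmetric] ennreal_mult[symmetric] divide_ennreal)
  also have "\<dots> = ennreal r * (\<integral>\<^sup>+z. ennreal (1 / 9) * indicator ({z. z + \<delta> \<in> S} \<inter> {1..<3}) z \<partial>lborel)"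
    by (subst nn_integral_cmult) auto
  also have "\<dots> \<le> ennreal r * (\<integral>\<^sup>+z. ?f (1 / z) * ennreal (1 / z\<^sup>2) * indicator {0<..} z \<partial>lborel)"
  proof (intro mult_left_mono nn_integral_mono_AE)
    \<comment> \<open>The point \<open>z = 1\<close> is sent to the boundary of the open
      ball.\<close>
    have "AE z in lborel. z \<noteq> (1::real)" by (rule AE_lborel_singleton)
    with irr show "AE z in lborel. ennreal (1 / 9) * indicator ({z. z + \<delta> \<in> S} \<inter> {1..<3}) z
      \<le> ?f (1 / z) * ennreal (1 / z\<^sup>2) * indicator {0<..} z"
    proof eventually_elim
      case (elim z)
      show ?case
      proof (cases "z + \<delta> \<in> S \<and> 1 \<le> z \<and> z < 3")
        case True
        then have "1 < z" using elim by auto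
        then have "r / z < r" using r by (simp add: field_simps)
        then have "t + s * r / z \<in> S \<inter> ball t r"
          using True cusp[of z] elim s r \<open>1 < z\<close> by (auto simp: dist_real_def)
        moreover have "1 / 9 \<le> 1 / z\<^sup>2"
          using True \<open>1 < z\<close> power_mono[of z 3 2] by (simp add: field_simps)
        ultimately show ?thesis using True \<open>1 < z\<close> by (auto intro!: ennreal_leI)
      qed (auto simp: indicator_def)
    qed
  qed simp
  also have "\<dots> = ennreal r * (\<integral>\<^sup>+x. ?f x * indicator {0<..} x \<partial>lborel)"
    using nn_integral_reciprocal[of ?f] by (simp add: borel_measurable_indicator')
  also have "\<dots> \<le> ennreal r * (\<integral>\<^sup>+x. ?f x \<partial>lborel)"
    by (intro mult_left_mono nn_integral_mono) (auto simp: indicator_def)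
  also have "\<dots> = ennreal \<bar>s * r\<bar> * (\<integral>\<^sup>+x. ?f x \<partial>lborel)" using s r by auto
  also have "\<dots> = (\<integral>\<^sup>+x. indicator (S \<inter> ball t r) x \<partial>lborel)"
    using s r nn_integral_real_affine[of "indicator (S \<inter> ball t r)" "s * r" t]
    by (auto simp: borel_measurable_indicator')
  finally show ?thesis by simp
qed

end

section \<open>Zero-one law by Vitali covering\<close>

text \<open>Let \<open>B\<close> be the complement within a period. Disjoint cusp balls fill an open
  set that exceeds \<open>B\<close> by less than \<open>\<epsilon>\<close>, and a fixed proportion
  \<open>c\<close> of each ball belongs to \<open>S\<close>, hence to the excess. So
  \<open>c\<close> times the measure of \<open>B\<close> is at most
  \<open>\<epsilon>\<close>.\<close>

lemma null_or_conull:
  fixes S :: "real set"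
  assumes S [measurable]: "S \<in> sets borel"
    and per: "\<And>x. x + 2 \<in> S \<longleftrightarrow> x \<in> S"
    and inv: "\<And>x. x \<notin> \<rat> \<Longrightarrow> x \<in> S \<longleftrightarrow> 1 / x + 1 \<in> S"
  shows "S \<in> null_sets lborel \<or> - S \<in> null_sets lborel"
proof (cases "emeasure lborel (S \<inter> {0..<2}) = 0")
  case False
  \<comment> \<open>A ball of radius \<open>r\<close> has length \<open>2 * r\<close> and contains
    at least \<open>r / 9\<close> times the mass of a period, whence 18.\<close>
  define c where "c = emeasure lborel (S \<inter> {0..<2}) / 18"
  have c0: "c \<noteq> 0" using False by (simp add: c_def ennreal_divide_eq_0_iff)
  define B where "B = - S \<inter> {0..<2}"
  have B [measurable]: "B \<in> sets borel" by (simp add: B_def)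
  have le: "c * emeasure lborel B \<le> ennreal \<epsilon>" if "0 < \<epsilon>" for \<epsilon>
  proof -
    have "B \<in> sets lebesgue" using B by simp
    then obtain T where T: "open T" "B \<subseteq> T" "emeasure lebesgue (T - B) < ennreal \<epsilon>"
      using sets_lebesgue_outer_open[of B \<epsilon>] \<open>0 < \<epsilon>\<close> by metis
    have [measurable]: "T \<in> sets borel" using T(1) by simp
    \<comment> \<open>Inside the open period a point of \<open>S\<close> lies outside
      \<open>B\<close>. Only the point 0 of \<open>B\<close> is lost.\<close>
    define U where "U = T \<inter> {0<..<2}"
    have "open U" using T by (simp add: U_def open_Int)
    have [measurable]: "U \<in> sets borel" by (simp add: U_def)
    \<comment> \<open>The radius \<open>1 / k\<^sup>2\<close> is both the scale of the local
      coordinate at the cusp \<open>h / k\<close> and the precision in Dirichlet's theorem.\<close>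
    define K where "K = {(h, k). coprime h k \<and> 0 < k \<and>
      ball (real_of_int h / of_int k) (1 / (of_int k)\<^sup>2) \<subseteq> U}"
    define ctr rad where "ctr = (\<lambda>(h, k). real_of_int h / of_int k)"
      and "rad = (\<lambda>(h::int, k). 1 / (real_of_int k)\<^sup>2)"
    obtain C where C: "countable C" "C \<subseteq> K"
      "pairwise (\<lambda>i j. disjnt (ball (ctr i) (rad i)) (ball (ctr j) (rad j))) C"
      "negligible (U - \<rat> - (\<Union>i\<in>C. ball (ctr i) (rad i)))"
    proof (rule Vitali_covering_theorem_balls[of "U - \<rat>" K ctr rad])
      fix x d :: real assume x: "x \<in> U - \<rat>" and "0 < d"
      then obtain e where e: "0 < e" "ball x e \<subseteq> U" using \<open>open U\<close> by (meson DiffD1 openE)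
      \<comment> \<open>Centre distance and radius are each below \<open>m\<close>, so
        \<open>e / 2\<close> keeps the cusp ball inside \<open>ball x e\<close>.\<close>
      define m where "m = min (e / 2) d"
      have "0 < m" using e \<open>0 < d\<close> by (simp add: m_def)
      obtain N :: nat where N: "1 / m < real N" using reals_Archimedean2 by blast
      \<comment> \<open>Dirichlet: an irrational has infinitely many reduced fractions within
        \<open>1 / k\<^sup>2\<close>, so \<open>k\<close> may be taken as large as desired.\<close>
      have "infinite (approx_set x)" using x rational_iff_finite_approx_set by blast
      then obtain h k where hk: "(h, k) \<in> approx_set x" "int N < k"
        using infinite_approx_set by blast
      then have k: "0 < k" "coprime h k" "\<bar>x - of_int h / of_int k\<bar> < 1 / (of_int k)\<^sup>2"
        by (auto simp: approx_set_def)
      have "1 / m < of_int k" using N hk(2) by linarith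
      also have "real_of_int k \<le> (of_int k)\<^sup>2" using k by (simp add: self_le_power)
      finally have rad: "1 / (of_int k)\<^sup>2 < m" using \<open>0 < m\<close> k by (simp add: field_simps)
      have "ball (of_int h / of_int k) (1 / (of_int k)\<^sup>2) \<subseteq> ball x e"
      proof
        fix y assume "y \<in> ball (of_int h / of_int k :: real) (1 / (of_int k)\<^sup>2)"
        then show "y \<in> ball x e" using k(3) rad by (auto simp: dist_real_def m_def)
      qed
      then have "(h, k) \<in> K" using e k by (auto simp: K_def)
      then show "\<exists>i. i \<in> K \<and> x \<in> ball (ctr i) (rad i) \<and> rad i < d"
        using k rad by (intro exI[of _ "(h, k)"]) (auto simp: ctr_def rad_def dist_real_def m_def)
    qed blast
    let ?b = "\<lambda>i. ball (ctr i) (rad i)"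
    have disj: "disjoint_family_on ?b C"
      using C(3) unfolding disjoint_family_on_def pairwise_def disjnt_def by blast
    then have disjS: "disjoint_family_on (\<lambda>i. S \<inter> ?b i) C"
      unfolding disjoint_family_on_def by blast
    have ball_le: "c * emeasure lborel (?b i) \<le> emeasure lborel (S \<inter> ?b i)" if "i \<in> C" for i
    proof -
      obtain h k where i: "i = (h, k)" by (cases i)
      have k: "coprime h k" "0 < k" using that C(2) by (auto simp: K_def i)
      obtain \<delta> s where s: "s \<in> {1, -1}" and
        eq: "\<And>z. z \<notin> \<rat> \<Longrightarrow> of_int h / of_int k + s / ((of_int k)\<^sup>2 * z) \<in> S \<longleftrightarrow> z + \<delta> \<in> S"
        using cusp_neighbourhood[of S h k, OF per inv] k by blast
      have "ennreal (rad i / 9) * emeasure lborel (S \<inter> {0..<2}) \<le> emeasure lborel (S \<inter> ?b i)"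
        using s eq k by (intro emeasure_cusp_ball[OF S per]) (auto simp: i ctr_def rad_def)
      moreover have "c * emeasure lborel (?b i) = ennreal (rad i / 9) * emeasure lborel (S \<inter> {0..<2})"
      proof -
        have r: "0 < rad i" using k by (simp add: i rad_def)
        have "emeasure lborel (?b i) = ennreal (18 * (rad i / 9))"
          using r by (simp add: ball_eq_greaterThanLessThan)
        also have "\<dots> = 18 * ennreal (rad i / 9)" using r by (subst ennreal_mult) auto
        finally have "emeasure lborel (?b i) = 18 * ennreal (rad i / 9)" .
        moreover have "c * 18 = emeasure lborel (S \<inter> {0..<2})"
          unfolding c_def by (simp add: ennreal_divide_times ennreal_divide_self)
        ultimately show ?thesis by (metis mult.assoc mult.commute)
      qed
      ultimately show ?thesis by simp
    qed
    have "(\<Union>i\<in>C. ?b i) \<subseteq> U" using C(2) by (auto simp: K_def ctr_def rad_def)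
    have "c * emeasure lborel B \<le> c * emeasure lborel (U \<union> {0})"
      using T(2) by (intro mult_left_mono emeasure_mono) (auto simp: B_def U_def)
    also have "emeasure lborel (U \<union> {0}) \<le> emeasure lborel U"
      using emeasure_subadditive[of U lborel "{0}"] by simp
    also have "emeasure lborel U \<le> emeasure lborel (\<Union>i\<in>C. ?b i)"
    proof (rule emeasure_mono_AE)
      have "U - \<rat> - (\<Union>i\<in>C. ?b i) \<in> sets lborel"
        using C(1) countable_rat by (auto intro!: sets.Diff sets.countable_UN'' intro: sets.countable)
      then have "U - \<rat> - (\<Union>i\<in>C. ?b i) \<in> null_sets lborel"
        using C(4) by (simp add: negligible_iff_null_sets null_sets_completion_iff)
      then have "AE x in lborel. x \<notin> U - \<rat> - (\<Union>i\<in>C. ?b i)" by (rule AE_not_in)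
      moreover have "AE z in lborel. (z::real) \<notin> \<rat>"
        using countable_imp_null_set_lborel[OF countable_rat] by (rule AE_not_in)
      ultimately show "AE x in lborel. x \<in> U \<longrightarrow> x \<in> (\<Union>i\<in>C. ?b i)"
        by eventually_elim auto
    qed (use C(1) in auto)
    also have "emeasure lborel (\<Union>i\<in>C. ?b i) = (\<integral>\<^sup>+i. emeasure lborel (?b i) \<partial>count_space C)"
      using C(1) disj by (intro emeasure_UN_countable) auto
    also have "c * \<dots> = (\<integral>\<^sup>+i. c * emeasure lborel (?b i) \<partial>count_space C)"
      by (simp add: nn_integral_cmult)
    also have "\<dots> \<le> (\<integral>\<^sup>+i. emeasure lborel (S \<inter> ?b i) \<partial>count_space C)"
      using ball_le by (intro nn_integral_mono) auto
    also have "\<dots> = emeasure lborel (\<Union>i\<in>C. S \<inter> ?b i)"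
      using C(1) disjS by (intro emeasure_UN_countable[symmetric]) auto
    also have "\<dots> \<le> emeasure lborel (T - B)"
      using \<open>(\<Union>i\<in>C. ?b i) \<subseteq> U\<close> by (intro emeasure_mono) (auto simp: U_def B_def)
    also have "\<dots> = emeasure lebesgue (T - B)" by simp
    also have "\<dots> \<le> ennreal \<epsilon>" using T(3) by simp
    finally show ?thesis by (simp add: mult_left_mono)
  qed
  have "c * emeasure lborel B \<le> 0"
  proof (rule ennreal_le_epsilon)
    fix e :: real assume "0 < e"
    then show "c * emeasure lborel B \<le> 0 + ennreal e" using le by simp
  qed
  then have "emeasure lborel B = 0" using c0 by simp
  then show ?thesis using S per by (intro disjI2 periodic_null) (auto simp: B_def)
qed (use periodic_null[OF S per] in blast)

section \<open>The invariant density\<close>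

text \<open>The integral of \<open>1 / (1 + x * t)\<^sup>2\<close> over \<open>t\<close> from 0 to
  \<open>y\<close>, as long as the denominator stays positive.\<close>

definition fibre_mass :: "real \<Rightarrow> real \<Rightarrow> real" where
  "fibre_mass y x = y / (1 + x * y)"

text \<open>The marginal density before normalisation, one summand per horizontal strip. The cuts
  are closed expressions instead of values of \<open>odd_map\<close>, so that one formula also
  serves both golden endpoints, where a strip degenerates.\<close>

definition inv_density :: "real \<Rightarrow> real \<Rightarrow> real" where
  "inv_density \<alpha> x =
    fibre_mass (2 - big_golden) x * indicator (alpha_interval \<alpha>) x +
    (fibre_mass 1 x - fibre_mass (2 - big_golden) x) * indicator {1 / \<alpha> - 1<..<\<alpha>} x +
    (fibre_mass big_golden x - fibre_mass 1 x) * indicator {(\<alpha> - 1) / (2 - \<alpha>)..<\<alpha>} x"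

lemma fibre_mass_mono:
  assumes "0 \<le> a" "a \<le> b" "0 < 1 + x * b"
  shows "0 < 1 + x * a" "fibre_mass a x \<le> fibre_mass b x"
proof -
  show pos: "0 < 1 + x * a"
  proof (cases "0 \<le> x")
    case False
    then have "x * b \<le> x * a" using assms by (intro mult_left_mono_neg) auto
    then show ?thesis using assms by linarith
  qed (use assms in \<open>simp add: add_pos_nonneg\<close>)
  have "a * (1 + x * b) \<le> b * (1 + x * a)" using assms by (simp add: algebra_simps)
  then show "fibre_mass a x \<le> fibre_mass b x"
    using pos assms by (simp add: fibre_mass_def frac_le_eq divide_simps)
qed

lemma nn_integral_section:
  assumes "0 \<le> a" "a \<le> b" "0 < 1 + x * b"
  shows "(\<integral>\<^sup>+y. ennreal (1 / (1 + x * y)\<^sup>2) * indicator {a..b} y \<partial>lborel)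
    = ennreal (fibre_mass b x - fibre_mass a x)"
proof (rule nn_integral_FTC_Icc)
  fix y assume "y \<in> {a..b}"
  then have "0 < 1 + x * y"
    using fibre_mass_mono(1)[of y b x] assms by auto
  then show "((\<lambda>y. fibre_mass y x) has_real_derivative 1 / (1 + x * y)\<^sup>2) (at y)"
    unfolding fibre_mass_def
    by (auto intro!: derivative_eq_intros simp: power2_eq_square field_simps)
qed (use assms in auto)

lemma nn_integral_kernel:
  assumes "0 \<le> a" "a \<le> b" "l \<le> u" and pos: "\<And>x. x \<in> {l..u} \<Longrightarrow> 0 < 1 + x * b"
  shows "(\<integral>\<^sup>+x. ennreal (fibre_mass b x - fibre_mass a x) * indicator {l..u} x \<partial>lborel)
    = ennreal ((ln (1 + u * b) - ln (1 + u * a)) - (ln (1 + l * b) - ln (1 + l * a)))"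
proof (rule nn_integral_FTC_Icc)
  fix x assume "x \<in> {l..u}"
  then have "0 < 1 + x * b" "0 < 1 + x * a" using pos fibre_mass_mono(1)[of a b x] assms by auto
  then show "((\<lambda>x. ln (1 + x * b) - ln (1 + x * a)) has_real_derivative fibre_mass b x - fibre_mass a x) (at x)"
    unfolding fibre_mass_def by (auto intro!: derivative_eq_intros simp: field_simps)
next
  show "(\<lambda>x. fibre_mass b x - fibre_mass a x) \<in> borel_measurable borel"
    unfolding fibre_mass_def by measurable
qed (use assms fibre_mass_mono(2)[of a b] in auto)

locale odd_expansion_parameter =
  fixes \<alpha> :: real
  assumes \<alpha>: "\<alpha> \<in> {small_golden..big_golden}"
begin

text \<open>\<open>\<beta>\<close> is the height of the lowest cut; \<open>p\<close> and
  \<open>q\<close> are the values of \<open>1 / \<bar>x\<bar> - 1\<close>, the branch of digit 1, at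
  \<open>\<alpha>\<close> and \<open>\<alpha> - 2\<close>.\<close>

abbreviation (input) "\<beta> \<equiv> 2 - big_golden"
abbreviation (input) "p \<equiv> 1 / \<alpha> - 1"
abbreviation (input) "q \<equiv> (\<alpha> - 1) / (2 - \<alpha>)"

lemma beta_bounds: "0 < \<beta>" "\<beta> < 1" "1 < big_golden"
  using big_golden_bounds by auto

lemma fibre_mass_denominator_pos:
  "\<alpha> - 2 \<le> x \<Longrightarrow> 0 < 1 + x * \<beta>"
  "p \<le> x \<Longrightarrow> 0 < 1 + x * 1"
  "q \<le> x \<Longrightarrow> 0 < 1 + x * big_golden"
proof -
  note b = alpha_bounds[OF \<alpha>] big_golden_bounds
  show "0 < 1 + x * \<beta>" if "\<alpha> - 2 \<le> x"
  proof -
    have "(- (3 / 2)) * \<beta> \<le> x * \<beta>" using b that by (intro mult_right_mono) auto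
    moreover have "- 1 < (- (3 / 2)) * \<beta>" using b by simp
    ultimately show ?thesis by linarith
  qed
  show "0 < 1 + x * 1" if "p \<le> x"
    using b that by (smt (verit) divide_pos_pos)
  show "0 < 1 + x * big_golden" if "q \<le> x"
  proof -
    have "q * big_golden \<le> x * big_golden" using b that by (intro mult_right_mono) auto
    moreover have "1 + q * big_golden = (\<beta> + \<alpha> * (big_golden - 1)) / (2 - \<alpha>)"
      using b by (simp add: field_simps)
    moreover have "0 < (\<beta> + \<alpha> * (big_golden - 1)) / (2 - \<alpha>)"
      using b by (intro divide_pos_pos add_pos_pos mult_pos_pos) auto
    ultimately show ?thesis by linarith
  qed
qed

text \<open>\<open>\<alpha> - 2 \<le> p\<close> and \<open>q \<le> \<alpha>\<close> both amount to
  \<open>\<alpha>\<^sup>2 \<le> \<alpha> + 1\<close>, and \<open>p \<le> \<alpha>\<close> to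
  \<open>1 \<le> \<alpha> + \<alpha>\<^sup>2\<close>. The remaining bound is positivity of
  \<open>\<alpha>\<^sup>2 - 3 * \<alpha> + 3\<close>.\<close>

lemma cut_points: "\<alpha> - 2 \<le> p" "p \<le> \<alpha>" "\<alpha> - 2 \<le> q" "q \<le> \<alpha>"
proof -
  note b = alpha_bounds[OF \<alpha>]
  show "\<alpha> - 2 \<le> p" "p \<le> \<alpha>" using b by (auto simp: field_simps power2_eq_square)
  show "q \<le> \<alpha>" using b by (auto simp: field_simps power2_eq_square)
  have "0 < (\<alpha> - 3 / 2)\<^sup>2 + 3 / 4" by (simp add: add_nonneg_pos)
  then show "\<alpha> - 2 \<le> q" using b by (auto simp: field_simps power2_eq_square)
qed

lemma inv_density_nonneg: "0 \<le> inv_density \<alpha> x"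
proof -
  have "0 \<le> fibre_mass \<beta> x" if "x \<in> alpha_interval \<alpha>"
    using fibre_mass_denominator_pos(1)[of x] beta_bounds that by (simp add: fibre_mass_def alpha_interval_def)
  moreover have "fibre_mass \<beta> x \<le> fibre_mass 1 x" if "p < x"
    using fibre_mass_denominator_pos(2)[of x] beta_bounds that by (intro fibre_mass_mono(2)) auto
  moreover have "fibre_mass 1 x \<le> fibre_mass big_golden x" if "q \<le> x"
    using fibre_mass_denominator_pos(3)[of x] beta_bounds that by (intro fibre_mass_mono(2)) auto
  ultimately show ?thesis by (auto simp: inv_density_def indicator_def)
qed

lemma borel_measurable_inv_density [measurable]: "inv_density \<alpha> \<in> borel_measurable borel"
  unfolding inv_density_def fibre_mass_def alpha_interval_def by measurable

lemma inv_density_outside: "x \<notin> alpha_interval \<alpha> \<Longrightarrow> inv_density \<alpha> x = 0"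
  using cut_points by (auto simp: inv_density_def alpha_interval_def indicator_def)

text \<open>Each strip contributes logarithms of \<open>1 + x * y\<close> at its corners; in the sum
  everything but the powers of \<open>big_golden\<close> cancels.\<close>

lemma nn_integral_inv_density: "(\<integral>\<^sup>+x. inv_density \<alpha> x \<partial>lborel) = ennreal (3 * ln big_golden)"
proof -
  let ?G = big_golden
  note b = alpha_bounds[OF \<alpha>] big_golden_bounds
  define F where "F a b l u = (ln (1 + u * b) - ln (1 + u * a)) - (ln (1 + l * b) - ln (1 + l * a))"
    for a b l u :: real
  define D where "D a b l u x = ennreal (fibre_mass b x - fibre_mass a x) * indicator {l..u} x"
    for a b l u x :: real
  have nn: "integral\<^sup>N lborel (D 0 \<beta> (\<alpha> - 2) \<alpha>) = ennreal (F 0 \<beta> (\<alpha> - 2) \<alpha>)"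
    "integral\<^sup>N lborel (D \<beta> 1 p \<alpha>) = ennreal (F \<beta> 1 p \<alpha>)"
    "integral\<^sup>N lborel (D 1 ?G q \<alpha>) = ennreal (F 1 ?G q \<alpha>)"
    unfolding D_def F_def using b cut_points fibre_mass_denominator_pos
    by (intro nn_integral_kernel; auto)+
  have meas [measurable]: "D a b l u \<in> borel_measurable borel" for a b l u
    unfolding D_def fibre_mass_def by measurable
  have "(\<integral>\<^sup>+x. inv_density \<alpha> x \<partial>lborel)
      = (\<integral>\<^sup>+x. (D 0 \<beta> (\<alpha> - 2) \<alpha> x + D \<beta> 1 p \<alpha> x) + D 1 ?G q \<alpha> x \<partial>lborel)"
  \<comment> \<open>Closing the strips changes the integrand at most at \<open>p\<close> and
    \<open>\<alpha>\<close>.\<close>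
  proof (rule nn_integral_cong_AE)
    show "AE x in lborel. ennreal (inv_density \<alpha> x)
        = (D 0 \<beta> (\<alpha> - 2) \<alpha> x + D \<beta> 1 p \<alpha> x) + D 1 ?G q \<alpha> x"
      using AE_lborel_singleton[of p] AE_lborel_singleton[of \<alpha>]
    proof eventually_elim
      case (elim x)
      have k: "0 \<le> fibre_mass \<beta> x" if "\<alpha> - 2 \<le> x"
        using fibre_mass_denominator_pos(1)[of x] beta_bounds that by (simp add: fibre_mass_def)
      have k1: "fibre_mass \<beta> x \<le> fibre_mass 1 x" if "p < x"
        using fibre_mass_denominator_pos(2)[of x] beta_bounds that by (intro fibre_mass_mono(2)) auto
      have k2: "fibre_mass 1 x \<le> fibre_mass ?G x" if "q \<le> x"
        using fibre_mass_denominator_pos(3)[of x] beta_bounds that by (intro fibre_mass_mono(2)) auto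
      have e: "ennreal (fibre_mass \<beta> x * indicator (alpha_interval \<alpha>) x) = D 0 \<beta> (\<alpha> - 2) \<alpha> x"
        "ennreal ((fibre_mass 1 x - fibre_mass \<beta> x) * indicator {p<..<\<alpha>} x) = D \<beta> 1 p \<alpha> x"
        "ennreal ((fibre_mass ?G x - fibre_mass 1 x) * indicator {q..<\<alpha>} x) = D 1 ?G q \<alpha> x"
        using elim by (auto simp: D_def indicator_def alpha_interval_def fibre_mass_def)
      have nn: "0 \<le> fibre_mass \<beta> x * indicator (alpha_interval \<alpha>) x"
        "0 \<le> (fibre_mass 1 x - fibre_mass \<beta> x) * indicator {p<..<\<alpha>} x"
        "0 \<le> (fibre_mass ?G x - fibre_mass 1 x) * indicator {q..<\<alpha>} x"
        using k k1 k2 by (auto simp: indicator_def alpha_interval_def)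
      show ?case
        unfolding inv_density_def e[symmetric] using nn by (simp only: ennreal_plus add_nonneg_nonneg)
    qed
  qed
  also have "\<dots> = ennreal (F 0 \<beta> (\<alpha> - 2) \<alpha>) + ennreal (F \<beta> 1 p \<alpha>) + ennreal (F 1 ?G q \<alpha>)"
    by (simp add: nn_integral_add nn)
  \<comment> \<open>\<open>ennreal\<close> truncates negative numbers to 0, so each term must be
    shown nonnegative before the sum is formed inside it.\<close>
  also have "\<dots> = ennreal (F 0 \<beta> (\<alpha> - 2) \<alpha> + F \<beta> 1 p \<alpha> + F 1 ?G q \<alpha>)"
  proof -
    have mono: "ln (1 + l * b) - ln (1 + l * a) \<le> ln (1 + u * b) - ln (1 + u * a)"
      if "0 \<le> a" "a \<le> b" "l \<le> u" "0 < 1 + l * b" for a b l u :: real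
    proof -
      have pos: "0 < 1 + l * a" "0 < 1 + u * b" "0 < 1 + u * a"
        using fibre_mass_mono(1)[of a b] that mult_right_mono[of l u b] by (auto intro: order.strict_trans2)
      have "(1 + l * b) * (1 + u * a) \<le> (1 + u * b) * (1 + l * a)"
        using mult_left_mono[of "l * (b - a)" "u * (b - a)" 1] mult_right_mono[of l u "b - a"] that
        by (simp add: algebra_simps)
      then have "ln ((1 + l * b) * (1 + u * a)) \<le> ln ((1 + u * b) * (1 + l * a))"
        using that pos by (subst ln_le_cancel_iff) auto
      then show ?thesis using that pos by (simp add: ln_mult)
    qed
    have "0 \<le> F 0 \<beta> (\<alpha> - 2) \<alpha>" "0 \<le> F \<beta> 1 p \<alpha>" "0 \<le> F 1 ?G q \<alpha>"
      unfolding F_def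
      using mono[OF _ _ _ fibre_mass_denominator_pos(1)[OF order_refl], of 0 \<alpha>]
        mono[OF _ _ _ fibre_mass_denominator_pos(2)[OF order_refl], of \<beta> \<alpha>]
        mono[OF _ _ _ fibre_mass_denominator_pos(3)[OF order_refl], of 1 \<alpha>]
        cut_points beta_bounds by simp_all
    then show ?thesis by simp
  qed
  also have "F 0 \<beta> (\<alpha> - 2) \<alpha> + F \<beta> 1 p \<alpha> + F 1 ?G q \<alpha> = 3 * ln ?G"
  proof -
    \<comment> \<open>The golden identity writes \<open>1 + x * y\<close> at the left corners as
      \<open>?L\<close> divided by a power of \<open>big_golden\<close> and possibly by
      \<open>\<alpha>\<close> or \<open>2 - \<alpha>\<close>; at height 1 only the latter factors
      remain.\<close>
    let ?L = "1 + \<alpha> * ?G"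
    have G3: "?G ^ 3 = 2 * ?G + 1"
      using big_golden_sq by (simp add: power3_eq_cube power2_eq_square algebra_simps)
    have sq: "?G * ?G = ?G + 1" using big_golden_sq by (simp add: power2_eq_square)
    have pos: "0 < ?L" "0 < ?G" "0 < \<alpha>" "0 < 2 - \<alpha>" using b by (auto intro!: add_pos_pos)
    have "(1 + (\<alpha> - 2) * \<beta>) * (2 * ?G + 1) = ?L" using sq by algebra
    then have "1 + (\<alpha> - 2) * \<beta> = ?L / ?G ^ 3"
      using pos unfolding G3 by (simp add: eq_divide_eq)
    then have 1: "ln (1 + (\<alpha> - 2) * \<beta>) = ln ?L - 3 * ln ?G"
      using pos by (simp add: ln_div ln_realpow)
    have "(\<alpha> + (1 - \<alpha>) * \<beta>) * (?G + 1) = ?L" using sq by algebra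
    then have "\<alpha> + (1 - \<alpha>) * \<beta> = ?L / ?G\<^sup>2"
      using pos unfolding big_golden_sq by (simp add: eq_divide_eq)
    moreover have "1 + p * \<beta> = (\<alpha> + (1 - \<alpha>) * \<beta>) / \<alpha>"
      using pos by (simp add: field_simps)
    ultimately have "1 + p * \<beta> = ?L / (\<alpha> * ?G\<^sup>2)" by simp
    then have 2: "ln (1 + p * \<beta>) = ln ?L - ln \<alpha> - 2 * ln ?G"
      using pos by (simp add: ln_div ln_realpow ln_mult)
    have "(2 - \<alpha> + (\<alpha> - 1) * ?G) * (?G + 1) = ?L" using sq by algebra
    then have "2 - \<alpha> + (\<alpha> - 1) * ?G = ?L / ?G\<^sup>2"
      using pos unfolding big_golden_sq by (simp add: eq_divide_eq)
    moreover have "1 + q * ?G = (2 - \<alpha> + (\<alpha> - 1) * ?G) / (2 - \<alpha>)"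
      using pos by (simp add: field_simps)
    ultimately have "1 + q * ?G = ?L / (?G\<^sup>2 * (2 - \<alpha>))" by simp
    then have 3: "ln (1 + q * ?G) = ln ?L - 2 * ln ?G - ln (2 - \<alpha>)"
      using pos by (simp add: ln_div ln_realpow ln_mult)
    have "1 + q * 1 = 1 / (2 - \<alpha>)" using pos by (simp add: field_simps)
    then have 4: "ln (1 + q * 1) = - ln (2 - \<alpha>)" using pos by (simp add: ln_div)
    have "1 + p * 1 = 1 / \<alpha>" by simp
    then have 5: "ln (1 + p * 1) = - ln \<alpha>" using pos by (simp add: ln_div)
    show ?thesis unfolding F_def 1 2 3 4 5 by simp
  qed
  finally show ?thesis .
qed

section \<open>The natural extension domain and its projection\<close>

text \<open>Away from the excluded parameter the quadratic inequality is strict, which gives the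
  endpoint digit 1. At the excluded parameter the floor jumps and the digit is 3.\<close>

lemma odd_map_endpoints:
  shows "\<alpha> \<noteq> small_golden \<Longrightarrow> odd_map \<alpha> \<alpha> = p"
    and "\<alpha> \<noteq> big_golden \<Longrightarrow> odd_map \<alpha> (\<alpha> - 2) = q"
proof -
  note b = alpha_bounds[OF \<alpha>]
  show "odd_map \<alpha> \<alpha> = p" if "\<alpha> \<noteq> small_golden"
  proof -
    have "(big_golden - 1)\<^sup>2 < \<alpha>\<^sup>2"
      using \<alpha> that big_golden_bounds by (intro power_strict_mono) (auto simp: small_golden_eq)
    then have "1 < \<alpha> + \<alpha>\<^sup>2"
      using \<alpha> by (simp add: power2_diff big_golden_sq small_golden_eq)
    then have "\<lfloor>1 / (2 * \<bar>\<alpha>\<bar>) + (1 - \<alpha>) / 2\<rfloor> = 0"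
      using b by (simp add: floor_eq_iff field_simps power2_eq_square)
    then show ?thesis using b by (simp add: odd_map_def odd_digit_def)
  qed
  show "odd_map \<alpha> (\<alpha> - 2) = q" if "\<alpha> \<noteq> big_golden"
  proof -
    have "(\<alpha> - big_golden) * (\<alpha> + (big_golden - 1)) < 0"
      using \<alpha> that b big_golden_bounds by (intro mult_neg_pos) auto
    then have "\<alpha>\<^sup>2 < \<alpha> + 1"
      using big_golden_sq by (simp add: algebra_simps power2_eq_square)
    moreover have "0 < (\<alpha> - 3 / 2)\<^sup>2 + 3 / 4" by (simp add: add_nonneg_pos)
    ultimately have "\<lfloor>1 / (2 * (2 - \<alpha>)) + (1 - \<alpha>) / 2\<rfloor> = 0"
      using b by (simp add: floor_eq_iff field_simps power2_eq_square)
    moreover have "\<bar>\<alpha> - 2\<bar> = 2 - \<alpha>" using b by simp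
    ultimately show ?thesis using b by (simp add: odd_map_def odd_digit_def field_simps)
  qed
qed

lemma nat_ext_domain_subset: "nat_ext_domain \<alpha> \<subseteq> alpha_interval \<alpha> \<times> UNIV"
  using cut_points odd_map_endpoints beta_bounds
  by (auto simp: nat_ext_domain_def alpha_interval_def small_golden_eq)

lemma nat_ext_domain_borel [measurable]: "nat_ext_domain \<alpha> \<in> sets borel"
  unfolding nat_ext_domain_def alpha_interval_def
  by (auto intro!: sets.Un borel_Times)

text \<open>A uniform description of the three cases of the domain. At \<open>small_golden\<close>
  the middle strip is empty since \<open>p = \<alpha>\<close>; at \<open>big_golden\<close> the top
  strip is empty since \<open>q = \<alpha>\<close>, while \<open>p = \<alpha> - 2\<close>. The
  excluded null set absorbs the differing boundary conventions.\<close>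

lemma nat_ext_domain_iff:
  assumes "x \<noteq> p" "y \<notin> {0, \<beta>, 1, big_golden}"
  shows "(x, y) \<in> nat_ext_domain \<alpha> \<longleftrightarrow>
    x \<in> alpha_interval \<alpha> \<and> y \<in> {0..\<beta>} \<or> x \<in> {p<..<\<alpha>} \<and> y \<in> {\<beta>..1} \<or> x \<in> {q..<\<alpha>} \<and> y \<in> {1..big_golden}"
proof -
  note b = alpha_bounds[OF \<alpha>] big_golden_bounds
  have sq: "big_golden * big_golden = big_golden + 1"
    using big_golden_sq by (simp add: power2_eq_square)
  consider "\<alpha> = small_golden" | "\<alpha> = big_golden" | "\<alpha> \<noteq> small_golden" "\<alpha> \<noteq> big_golden" by blast
  then show ?thesis
  proof cases
    case 1
    then have "\<alpha> = big_golden - 1" by (simp only: small_golden_eq)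
    then have "\<alpha> * (\<alpha> + 1) = 1" using sq by (simp only:) (simp add: algebra_simps)
    then have p: "p = \<alpha>" using b by (simp add: field_simps)
    show ?thesis using assms 1 b unfolding p
      by (auto simp: nat_ext_domain_def alpha_interval_def small_golden_eq)
  next
    case 2
    then have p: "p = \<alpha> - 2" and q: "q = \<alpha>" using b sq by (simp_all add: field_simps)
    show ?thesis using assms 2 b unfolding p q
      by (auto simp: nat_ext_domain_def alpha_interval_def small_golden_eq)
  next
    case 3
    then show ?thesis using assms odd_map_endpoints b
      by (auto simp: nat_ext_domain_def alpha_interval_def small_golden_eq)
  qed
qed

lemma nn_integral_fibre:
  assumes "x \<noteq> p"
  shows "(\<integral>\<^sup>+y. ennreal (1 / (1 + x * y)\<^sup>2) * indicator (nat_ext_domain \<alpha>) (x, y) \<partial>lborel)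
    = ennreal (inv_density \<alpha> x)"
proof -
  let ?G = big_golden
  note b = alpha_bounds[OF \<alpha>] big_golden_bounds
  let ?e = "\<lambda>y. ennreal (1 / (1 + x * y)\<^sup>2)"
  define i :: "real set \<Rightarrow> ennreal" where "i A = indicator A x" for A
  have "(\<integral>\<^sup>+y. ?e y * indicator (nat_ext_domain \<alpha>) (x, y) \<partial>lborel) =
    (\<integral>\<^sup>+y. i (alpha_interval \<alpha>) * (?e y * indicator {0..\<beta>} y) + i {p<..<\<alpha>} * (?e y * indicator {\<beta>..1} y)
      + i {q..<\<alpha>} * (?e y * indicator {1..?G} y) \<partial>lborel)"
  proof (rule nn_integral_cong_AE)
    show "AE y in lborel. ?e y * indicator (nat_ext_domain \<alpha>) (x, y) =
      i (alpha_interval \<alpha>) * (?e y * indicator {0..\<beta>} y) + i {p<..<\<alpha>} * (?e y * indicator {\<beta>..1} y)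
      + i {q..<\<alpha>} * (?e y * indicator {1..?G} y)"
      using AE_lborel_singleton[of 0] AE_lborel_singleton[of \<beta>] AE_lborel_singleton[of 1]
        AE_lborel_singleton[of ?G]
    proof eventually_elim
      case (elim y)
      then have y: "y \<notin> {0, \<beta>, 1, ?G}" by simp
      consider "y < 0" | "y \<in> {0<..<\<beta>}" | "y \<in> {\<beta><..<1}" | "y \<in> {1<..<?G}" | "?G < y"
        using y by fastforce
      then show ?case
        using beta_bounds
        by cases (auto simp: i_def indicator_def nat_ext_domain_iff[OF assms y])
    qed
  qed
  also have "\<dots> = i (alpha_interval \<alpha>) * (\<integral>\<^sup>+y. ?e y * indicator {0..\<beta>} y \<partial>lborel)
      + i {p<..<\<alpha>} * (\<integral>\<^sup>+y. ?e y * indicator {\<beta>..1} y \<partial>lborel)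
      + i {q..<\<alpha>} * (\<integral>\<^sup>+y. ?e y * indicator {1..?G} y \<partial>lborel)"
    by (simp add: nn_integral_add nn_integral_cmult)
  also have "\<dots> = i (alpha_interval \<alpha>) * ennreal (fibre_mass \<beta> x - fibre_mass 0 x)
      + i {p<..<\<alpha>} * ennreal (fibre_mass 1 x - fibre_mass \<beta> x)
      + i {q..<\<alpha>} * ennreal (fibre_mass ?G x - fibre_mass 1 x)"
  proof -
    have "i (alpha_interval \<alpha>) * (\<integral>\<^sup>+y. ?e y * indicator {0..\<beta>} y \<partial>lborel)
        = i (alpha_interval \<alpha>) * ennreal (fibre_mass \<beta> x - fibre_mass 0 x)"
      using fibre_mass_denominator_pos(1)[of x] beta_bounds
      by (cases "x \<in> alpha_interval \<alpha>") (auto simp: i_def alpha_interval_def nn_integral_section)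
    moreover have "i {p<..<\<alpha>} * (\<integral>\<^sup>+y. ?e y * indicator {\<beta>..1} y \<partial>lborel)
        = i {p<..<\<alpha>} * ennreal (fibre_mass 1 x - fibre_mass \<beta> x)"
      using fibre_mass_denominator_pos(2)[of x] beta_bounds
      by (cases "x \<in> {p<..<\<alpha>}") (auto simp: i_def nn_integral_section)
    moreover have "i {q..<\<alpha>} * (\<integral>\<^sup>+y. ?e y * indicator {1..?G} y \<partial>lborel)
        = i {q..<\<alpha>} * ennreal (fibre_mass ?G x - fibre_mass 1 x)"
      using fibre_mass_denominator_pos(3)[of x] beta_bounds
      by (cases "x \<in> {q..<\<alpha>}") (auto simp: i_def nn_integral_section)
    ultimately show ?thesis by simp
  qed
  also have "\<dots> = ennreal (inv_density \<alpha> x)"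
  proof -
    have "0 \<le> fibre_mass \<beta> x" if "x \<in> alpha_interval \<alpha>"
      using fibre_mass_denominator_pos(1)[of x] beta_bounds that by (simp add: fibre_mass_def alpha_interval_def)
    moreover have "fibre_mass \<beta> x \<le> fibre_mass 1 x" if "p < x"
      using fibre_mass_denominator_pos(2)[of x] beta_bounds that by (intro fibre_mass_mono(2)) auto
    moreover have "fibre_mass 1 x \<le> fibre_mass ?G x" if "q \<le> x"
      using fibre_mass_denominator_pos(3)[of x] beta_bounds that by (intro fibre_mass_mono(2)) auto
    moreover have "fibre_mass 0 x = 0" by (simp add: fibre_mass_def)
    ultimately show ?thesis
      by (auto simp: i_def inv_density_def indicator_def simp flip: ennreal_plus)
  qed
  finally show ?thesis .
qed

lemma space_alpha_measure: "space (alpha_measure \<alpha>) = alpha_interval \<alpha>"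
  and sets_alpha_measure: "sets (alpha_measure \<alpha>) = sets (restrict_space borel (alpha_interval \<alpha>))"
  by (simp_all add: alpha_measure_def space_restrict_space)

text \<open>By Tonelli the second coordinate is integrated first; the fibre formula holds for every
  \<open>x\<close> except possibly \<open>p\<close>.\<close>

lemma emeasure_alpha_measure:
  assumes E: "E \<in> sets borel" "E \<subseteq> alpha_interval \<alpha>"
  shows "emeasure (alpha_measure \<alpha>) E =
    ennreal (1 / (3 * ln big_golden)) * (\<integral>\<^sup>+x. ennreal (inv_density \<alpha> x) * indicator E x \<partial>lborel)"
proof -
  let ?\<Omega> = "nat_ext_domain \<alpha>"
  let ?f = "\<lambda>(x, y). ennreal (1 / (1 + x * y)\<^sup>2)"
  note [measurable] = E(1)
  have f [measurable]: "?f \<in> borel_measurable (borel :: (real \<times> real) measure)"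
    by (simp add: borel_prod[symmetric])
  have fr: "?f \<in> borel_measurable (restrict_space lborel ?\<Omega>)"
    by (rule measurable_restrict_space1) simp
  have sp: "space (nat_ext_prob \<alpha>) = ?\<Omega>"
    by (simp add: nat_ext_prob_def nat_ext_measure_def space_scale_measure space_restrict_space)
  have se: "sets (nat_ext_prob \<alpha>) = sets (restrict_space lborel ?\<Omega>)"
    by (simp add: nat_ext_prob_def nat_ext_measure_def)
  have fst_b: "fst \<in> measurable (borel :: (real \<times> real) measure) (borel :: real measure)"
    by (simp add: borel_prod[symmetric])
  have "fst \<in> measurable (restrict_space lborel ?\<Omega>) (restrict_space borel (alpha_interval \<alpha>))"
    using nat_ext_domain_subset fst_b
    by (intro measurable_restrict_space2 measurable_restrict_space1) (auto simp: space_restrict_space)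
  then have fst_m: "fst \<in> measurable (nat_ext_prob \<alpha>) (restrict_space borel (alpha_interval \<alpha>))"
    by (simp add: measurable_cong_sets[OF se refl])
  have Er: "E \<in> sets (restrict_space borel (alpha_interval \<alpha>))"
    using E by (subst sets_restrict_space_iff) (auto simp: alpha_interval_def)
  have pre: "fst -` E \<inter> ?\<Omega> \<in> sets (restrict_space lborel ?\<Omega>)"
    using measurable_sets[OF fst_m Er] by (simp add: sp se)
  have "emeasure (alpha_measure \<alpha>) E = emeasure (nat_ext_prob \<alpha>) (fst -` E \<inter> ?\<Omega>)"
    unfolding alpha_measure_def using fst_m Er by (simp add: emeasure_distr sp)
  also have "\<dots> = ennreal (1 / (3 * ln big_golden)) * emeasure (nat_ext_measure \<alpha>) (fst -` E \<inter> ?\<Omega>)"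
    by (simp add: nat_ext_prob_def)
  also have "emeasure (nat_ext_measure \<alpha>) (fst -` E \<inter> ?\<Omega>)
      = (\<integral>\<^sup>+z. ?f z * indicator (fst -` E \<inter> ?\<Omega>) z \<partial>restrict_space lborel ?\<Omega>)"
    unfolding nat_ext_measure_def by (rule emeasure_density[OF fr pre])
  also have "\<dots> = (\<integral>\<^sup>+z. ?f z * indicator (fst -` E \<inter> ?\<Omega>) z * indicator ?\<Omega> z \<partial>lborel)"
    by (rule nn_integral_restrict_space) simp
  also have "\<dots> = (\<integral>\<^sup>+z. (case z of (x, y) \<Rightarrow> indicator E x * (ennreal (1 / (1 + x * y)\<^sup>2) * indicator ?\<Omega> (x, y)))
      \<partial>(lborel \<Otimes>\<^sub>M lborel))"
    unfolding lborel_prod by (intro nn_integral_cong) (auto simp: indicator_def)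
  also have "\<dots> = (\<integral>\<^sup>+x. \<integral>\<^sup>+y. indicator E x * (ennreal (1 / (1 + x * y)\<^sup>2) * indicator ?\<Omega> (x, y)) \<partial>lborel \<partial>lborel)"
  proof (subst lborel.nn_integral_fst[symmetric])
    have "?\<Omega> \<in> sets (borel \<Otimes>\<^sub>M borel)"
      unfolding borel_prod by (rule nat_ext_domain_borel)
    then show "(\<lambda>(x, y). indicator E x * (ennreal (1 / (1 + x * y)\<^sup>2) * indicator ?\<Omega> (x, y)))
        \<in> borel_measurable (lborel \<Otimes>\<^sub>M lborel)"
      by measurable
  qed simp
  also have "\<dots> = (\<integral>\<^sup>+x. ennreal (inv_density \<alpha> x) * indicator E x \<partial>lborel)"
  proof (rule nn_integral_cong_AE)
    have sec: "(\<lambda>y. ennreal (1 / (1 + x * y)\<^sup>2) * indicator ?\<Omega> (x, y)) \<in> borel_measurable lborel" for x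
    proof -
      have "?\<Omega> \<in> sets (borel \<Otimes>\<^sub>M borel)"
      unfolding borel_prod by (rule nat_ext_domain_borel)
      then show ?thesis by measurable
    qed
    show "AE x in lborel. (\<integral>\<^sup>+y. indicator E x * (ennreal (1 / (1 + x * y)\<^sup>2) * indicator ?\<Omega> (x, y)) \<partial>lborel)
        = ennreal (inv_density \<alpha> x) * indicator E x"
      using AE_lborel_singleton[of p]
    proof eventually_elim
      case (elim x)
      then show ?case
        by (subst nn_integral_cmult[OF sec]) (simp only: nn_integral_fibre[OF elim], rule mult.commute)
    qed
  qed
  finally show ?thesis .
qed

end

section \<open>Invariance of the density\<close>

lemma nn_integral_atLeast_periods:
  fixes f :: "real \<Rightarrow> ennreal"
  assumes [measurable]: "f \<in> borel_measurable borel"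
  shows "(\<integral>\<^sup>+x. f x * indicator {a..} x \<partial>lborel)
    = (\<integral>\<^sup>+t. (\<Sum>k. f (t + 2 * real k)) * indicator {a..<a + 2} t \<partial>lborel)"
proof -
  define J where "J k = {a + 2 * real k..<a + 2 * real k + 2}" for k
  have [measurable]: "J k \<in> sets borel" for k by (simp add: J_def)
  have disj: "disjoint_family J"
  proof -
    have "J i \<inter> J j = {}" if "i < j" for i j
    proof -
      have "real i + 1 \<le> real j" using that by linarith
      then show ?thesis by (auto simp: J_def)
    qed
    then show ?thesis
      unfolding disjoint_family_on_def by (metis inf_commute linorder_neqE_nat)
  qed
  have "(\<Union>k. J k) = {a..}"
  proof (intro equalityI subsetI)
    fix x assume "x \<in> {a..}"
    define k where "k = nat \<lfloor>(x - a) / 2\<rfloor>"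
    have "real k = of_int \<lfloor>(x - a) / 2\<rfloor>" using \<open>x \<in> {a..}\<close> by (simp add: k_def)
    then have "x \<in> J k"
      using floor_correct[of "(x - a) / 2"] by (simp add: J_def field_simps)
    then show "x \<in> (\<Union>k. J k)" by blast
  qed (auto simp: J_def)
  then have ind: "indicator {a..} x = (\<Sum>k. indicator (J k) x :: ennreal)" for x
    using suminf_indicator[OF disj, of x] by simp
  have "(\<integral>\<^sup>+x. f x * indicator {a..} x \<partial>lborel) = (\<integral>\<^sup>+x. (\<Sum>k. f x * indicator (J k) x) \<partial>lborel)"
    by (simp add: ind)
  also have "\<dots> = (\<Sum>k. \<integral>\<^sup>+x. f x * indicator (J k) x \<partial>lborel)"
    by (rule nn_integral_suminf) simp
  also have "\<dots> = (\<Sum>k. \<integral>\<^sup>+t. f (t + 2 * real k) * indicator {a..<a + 2} t \<partial>lborel)"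
  proof (rule suminf_cong)
    fix k
    have "(\<integral>\<^sup>+x. f x * indicator (J k) x \<partial>lborel)
        = (\<integral>\<^sup>+t. f (2 * real k + 1 * t) * indicator (J k) (2 * real k + 1 * t) \<partial>lborel)"
      by (subst nn_integral_real_affine[of _ 1 "2 * real k"]) auto
    also have "\<dots> = (\<integral>\<^sup>+t. f (t + 2 * real k) * indicator {a..<a + 2} t \<partial>lborel)"
      by (intro nn_integral_cong) (auto simp: J_def indicator_def add.commute)
    finally show "(\<integral>\<^sup>+x. f x * indicator (J k) x \<partial>lborel)
        = (\<integral>\<^sup>+t. f (t + 2 * real k) * indicator {a..<a + 2} t \<partial>lborel)" .
  qed
  also have "\<dots> = (\<integral>\<^sup>+t. (\<Sum>k. f (t + 2 * real k) * indicator {a..<a + 2} t) \<partial>lborel)"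
    by (rule nn_integral_suminf[symmetric]) simp
  finally show ?thesis by simp
qed

text \<open>The representative of \<open>z\<close> modulo 2 in
  \<open>alpha_interval \<alpha>\<close>; the final \<open>- 2\<close> places it below
  \<open>\<alpha>\<close>.\<close>

definition reduce :: "real \<Rightarrow> real \<Rightarrow> real" where
  "reduce \<alpha> z = z - 2 * of_int \<lfloor>(z - \<alpha>) / 2\<rfloor> - 2"

lemma borel_measurable_reduce [measurable]: "reduce \<alpha> \<in> borel_measurable borel"
  unfolding reduce_def by measurable

lemma reduce_in_alpha_interval: "reduce \<alpha> z \<in> alpha_interval \<alpha>"
  using floor_correct[of "(z - \<alpha>) / 2"] by (simp add: reduce_def alpha_interval_def field_simps)

lemma reduce_shift: "reduce \<alpha> (z + 2 * of_int k) = reduce \<alpha> z"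
proof -
  have "(z + 2 * of_int k - \<alpha>) / 2 = (z - \<alpha>) / 2 + of_int k" by (simp add: field_simps)
  then have "\<lfloor>(z + 2 * of_int k - \<alpha>) / 2\<rfloor> = \<lfloor>(z - \<alpha>) / 2\<rfloor> + k" by (metis floor_add_int)
  then show ?thesis by (simp add: reduce_def)
qed

lemma reduce_id: "x \<in> alpha_interval \<alpha> \<Longrightarrow> reduce \<alpha> x = x"
proof -
  assume "x \<in> alpha_interval \<alpha>"
  then have "\<lfloor>(x - \<alpha>) / 2\<rfloor> = -1" by (simp add: floor_eq_iff alpha_interval_def)
  then show ?thesis by (simp add: reduce_def)
qed

text \<open>An odd digit is an even integer plus 1, so subtracting it is, modulo 2, the same as
  adding 1.\<close>

lemma odd_map_eq_reduce: "x \<noteq> 0 \<Longrightarrow> odd_map \<alpha> x = reduce \<alpha> (1 / \<bar>x\<bar> + 1)"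
proof -
  assume "x \<noteq> 0"
  have "(1 / \<bar>x\<bar> + 1 - \<alpha>) / 2 = 1 / (2 * \<bar>x\<bar>) + (1 - \<alpha>) / 2" by (simp add: field_simps)
  then show ?thesis
    using \<open>x \<noteq> 0\<close> unfolding odd_map_def odd_digit_def reduce_def by (simp only:) simp
qed

lemma borel_measurable_odd_map [measurable]: "odd_map \<alpha> \<in> borel_measurable borel"
  unfolding odd_map_def odd_digit_def by measurable

section \<open>Telescoping of the image density\<close>

context odd_expansion_parameter
begin

lemma odd_map_in_alpha_interval: "odd_map \<alpha> x \<in> alpha_interval \<alpha>"
  using reduce_in_alpha_interval[of \<alpha> "1 / \<bar>x\<bar> + 1"] alpha_bounds[OF \<alpha>] odd_map_eq_reduce[of x \<alpha>]
  by (cases "x = 0") (auto simp: odd_map_def alpha_interval_def)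

text \<open>The density of the image of \<open>inv_density \<alpha>\<close> under \<open>x \<mapsto> 1 / \<bar>x\<bar>\<close> is a difference
  \<open>\<Psi> z - \<Psi> (z + 2)\<close> with \<open>\<Psi> z = 1 / (z - \<beta>) + tail (z - 2)\<close> once \<open>z \<ge> \<alpha> + 1\<close>.\<close>

definition tail :: "real \<Rightarrow> real" where
  "tail w =
    (if \<alpha> \<le> 1 then if \<alpha> \<le> (1 - \<alpha>) * w then 1 / (w + \<beta>) - 1 / (w + 1) else 0
     else if 2 - \<alpha> < (\<alpha> - 1) * w then 1 / (w + 1) - 1 / (w + big_golden) else 0)"

text \<open>For positive \<open>z\<close> the summands come from the preimages \<open>1 / z\<close>
  and \<open>- (1 / z)\<close> under \<open>x \<mapsto> 1 / \<bar>x\<bar>\<close>. Both involve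
  \<open>tail\<close>, with arguments differing by 2, which makes the telescoping visible.\<close>

definition pushed_density :: "real \<Rightarrow> real" where
  "pushed_density z =
    (if 1 / \<alpha> < z then 1 / z - 1 / (z + big_golden) - tail z else 0) +
    (if 1 / (2 - \<alpha>) \<le> z then 1 / (z - \<beta>) - 1 / z + tail (z - 2) else 0)"

lemma borel_measurable_pushed_density [measurable]: "pushed_density \<in> borel_measurable borel"
  unfolding pushed_density_def tail_def by measurable

lemma fibre_mass_reciprocal:
  assumes "0 < z"
  shows "0 \<le> y \<Longrightarrow> fibre_mass y (1 / z) / z\<^sup>2 = 1 / z - 1 / (z + y)"
    and "z \<noteq> y \<Longrightarrow> fibre_mass y (- (1 / z)) / z\<^sup>2 = 1 / (z - y) - 1 / z"
proof -
  assume "0 \<le> y"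
  then have "z + y \<noteq> 0" using assms by linarith
  then show "fibre_mass y (1 / z) / z\<^sup>2 = 1 / z - 1 / (z + y)"
    using assms by (simp add: fibre_mass_def divide_simps power2_eq_square; simp add: algebra_simps)
next
  assume "z \<noteq> y"
  then show "fibre_mass y (- (1 / z)) / z\<^sup>2 = 1 / (z - y) - 1 / z"
    using assms by (simp add: fibre_mass_def divide_simps power2_eq_square; simp add: algebra_simps)
qed

text \<open>If all three strips lie over \<open>1 / z\<close> the sum is
  \<open>1 / z - 1 / (z + big_golden)\<close>. Only one strip can be missing, the middle one for
  \<open>\<alpha> \<le> 1\<close> and the top one otherwise; \<open>tail z\<close> is its
  contribution.\<close>

lemma inv_density_reciprocal:
  assumes z: "0 < z"
  shows "inv_density \<alpha> (1 / z) / z\<^sup>2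
    = (if 1 / \<alpha> < z then 1 / z - 1 / (z + big_golden) - tail z else 0)"
proof (cases "1 / \<alpha> < z")
  case False
  then have "1 / z \<notin> alpha_interval \<alpha>"
    using z alpha_bounds[OF \<alpha>] by (auto simp: alpha_interval_def field_simps)
  then show ?thesis using False by (simp add: inv_density_outside)
next
  case True
  note b = alpha_bounds[OF \<alpha>] big_golden_bounds
  have lt: "1 / z < \<alpha>" using True z b by (simp add: field_simps)
  have pos: "0 < 1 / z" using z by simp
  have "\<alpha> - 2 \<le> 1 / z" using pos b by linarith
  then have I: "1 / z \<in> alpha_interval \<alpha>" using lt by (simp add: alpha_interval_def)
  have rec: "fibre_mass \<beta> (1 / z) / z\<^sup>2 = 1 / z - 1 / (z + \<beta>)"
    "fibre_mass 1 (1 / z) / z\<^sup>2 = 1 / z - 1 / (z + 1)"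
    "fibre_mass big_golden (1 / z) / z\<^sup>2 = 1 / z - 1 / (z + big_golden)"
    using b z by (intro fibre_mass_reciprocal(1); simp)+
  have p: "p < 1 / z \<longleftrightarrow> \<not> \<alpha> \<le> (1 - \<alpha>) * z" using z b by (simp add: field_simps; auto simp: algebra_simps)
  have q: "q \<le> 1 / z \<longleftrightarrow> \<not> 2 - \<alpha> < (\<alpha> - 1) * z" using z b by (simp add: field_simps; auto simp: algebra_simps)
  show ?thesis
  proof (cases "\<alpha> \<le> 1")
    case le: True
    then have "(\<alpha> - 1) * z \<le> 0" using z by (simp add: mult_nonpos_nonneg)
    then have q1: "q \<le> 1 / z" using q b by simp
    show ?thesis
    proof (cases "p < 1 / z")
      case T: True
      then have "\<not> \<alpha> \<le> (1 - \<alpha>) * z" using p by blast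
      then show ?thesis using True T le I lt q1 rec
        by (simp add: inv_density_def tail_def indicator_def add_divide_distrib diff_divide_distrib)
    next
      case F: False
      then have "\<alpha> \<le> (1 - \<alpha>) * z" using p by blast
      then show ?thesis using True F le I lt q1 rec
        by (simp add: inv_density_def tail_def indicator_def add_divide_distrib diff_divide_distrib)
    qed
  next
    case gt: False
    then have "(1 - \<alpha>) * z \<le> 0" using z by (simp add: mult_nonpos_nonneg)
    then have p1: "p < 1 / z" using p b by simp
    show ?thesis
    proof (cases "q \<le> 1 / z")
      case T: True
      then have "\<not> 2 - \<alpha> < (\<alpha> - 1) * z" using q by blast
      then show ?thesis using True T gt I lt p1 rec
        by (simp add: inv_density_def tail_def indicator_def add_divide_distrib diff_divide_distrib)
    next
      case F: False
      then have "2 - \<alpha> < (\<alpha> - 1) * z" using q by blast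
      then show ?thesis using True F gt I lt p1 rec
        by (simp add: inv_density_def tail_def indicator_def add_divide_distrib diff_divide_distrib)
    qed
  qed
qed

text \<open>Over \<open>- (1 / z)\<close> at most one strip joins the lowest one: the top one for
  \<open>\<alpha> \<le> 1\<close>, the middle one otherwise. It contributes
  \<open>tail (z - 2)\<close> because \<open>\<beta> + big_golden = 2\<close>.\<close>

lemma inv_density_neg_reciprocal:
  assumes z: "0 < z"
  shows "inv_density \<alpha> (- (1 / z)) / z\<^sup>2
    = (if 1 / (2 - \<alpha>) \<le> z then 1 / (z - \<beta>) - 1 / z + tail (z - 2) else 0)"
proof (cases "1 / (2 - \<alpha>) \<le> z")
  case False
  then have "- (1 / z) \<notin> alpha_interval \<alpha>"
    using z alpha_bounds[OF \<alpha>] by (auto simp: alpha_interval_def field_simps)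
  then show ?thesis using False by (simp add: inv_density_outside)
next
  case True
  note b = alpha_bounds[OF \<alpha>] big_golden_bounds
  have pos: "0 < 1 / z" using z by simp
  have ge: "1 / z \<le> 2 - \<alpha>" using True z b by (simp add: field_simps)
  have lt: "- (1 / z) < \<alpha>" using pos b by linarith
  then have I: "- (1 / z) \<in> alpha_interval \<alpha>" using ge by (simp add: alpha_interval_def)
  have zy: "y < z" if "0 < 1 + (- (1 / z)) * y" for y
    using that z by (simp add: field_simps)
  have k: "fibre_mass \<beta> (- (1 / z)) / z\<^sup>2 = 1 / (z - \<beta>) - 1 / z"
    using zy[OF fibre_mass_denominator_pos(1)[of "- (1 / z)"]] ge z
    by (intro fibre_mass_reciprocal(2)) auto
  have k1: "fibre_mass 1 (- (1 / z)) / z\<^sup>2 = 1 / (z - 1) - 1 / z" if "p < - (1 / z)"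
    using zy[OF fibre_mass_denominator_pos(2)[of "- (1 / z)"]] that z
    by (intro fibre_mass_reciprocal(2)) auto
  have k2: "fibre_mass 1 (- (1 / z)) / z\<^sup>2 = 1 / (z - 1) - 1 / z"
    "fibre_mass big_golden (- (1 / z)) / z\<^sup>2 = 1 / (z - big_golden) - 1 / z" if "q \<le> - (1 / z)"
  proof -
    have "big_golden < z" using zy[OF fibre_mass_denominator_pos(3)[of "- (1 / z)"]] that by simp
    then show "fibre_mass 1 (- (1 / z)) / z\<^sup>2 = 1 / (z - 1) - 1 / z"
      "fibre_mass big_golden (- (1 / z)) / z\<^sup>2 = 1 / (z - big_golden) - 1 / z"
      using z b by (intro fibre_mass_reciprocal(2); simp)+
  qed
  have p: "p < - (1 / z) \<longleftrightarrow> 2 - \<alpha> < (\<alpha> - 1) * (z - 2)"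
    using z b by (simp add: field_simps; auto simp: algebra_simps)
  have q: "q \<le> - (1 / z) \<longleftrightarrow> \<alpha> \<le> (1 - \<alpha>) * (z - 2)"
    using z b by (simp add: field_simps; auto simp: algebra_simps)
  have shift: "z - 2 + \<beta> = z - big_golden" "z - 2 + 1 = z - 1" "z - 2 + big_golden = z - \<beta>"
    by simp_all
  show ?thesis
  proof (cases "\<alpha> \<le> 1")
    case le: True
    then have "0 \<le> p" using b by (simp add: field_simps)
    then have p1: "\<not> p < - (1 / z)" using pos by linarith
    show ?thesis
    proof (cases "q \<le> - (1 / z)")
      case True
      then show ?thesis using \<open>1 / (2 - \<alpha>) \<le> z\<close> le I lt p1 k k2 q unfolding tail_def shift
        by (simp add: inv_density_def indicator_def add_divide_distrib diff_divide_distrib)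
    next
      case False
      then show ?thesis using \<open>1 / (2 - \<alpha>) \<le> z\<close> le I lt p1 k q unfolding tail_def shift
        by (simp add: inv_density_def indicator_def)
    qed
  next
    case gt: False
    then have "0 < q" using b by simp
    then have q1: "\<not> q \<le> - (1 / z)" using pos by linarith
    show ?thesis
    proof (cases "p < - (1 / z)")
      case True
      then show ?thesis using \<open>1 / (2 - \<alpha>) \<le> z\<close> gt I lt q1 k k1 p unfolding tail_def shift
        by (simp add: inv_density_def indicator_def add_divide_distrib diff_divide_distrib)
    next
      case False
      then show ?thesis using \<open>1 / (2 - \<alpha>) \<le> z\<close> gt I lt q1 k p unfolding tail_def shift
        by (simp add: inv_density_def indicator_def)
    qed
  qed
qed

lemma pushed_density_eq:
  assumes "0 < z"
  shows "pushed_density z = (inv_density \<alpha> (1 / z) + inv_density \<alpha> (- (1 / z))) / z\<^sup>2"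
  using assms
  by (simp add: pushed_density_def inv_density_reciprocal[symmetric]
      inv_density_neg_reciprocal[symmetric] add_divide_distrib)

text \<open>Allows the unfolding into periods to start at \<open>\<alpha> - 1\<close>: both
  thresholds are positive and at least that large.\<close>

lemma pushed_density_eq_0:
  assumes "z \<le> 0 \<or> z < \<alpha> - 1"
  shows "pushed_density z = 0"
proof -
  note b = alpha_bounds[OF \<alpha>]
  have "0 < 1 / \<alpha>" "0 < 1 / (2 - \<alpha>)" using b by auto
  moreover have "\<alpha> - 1 \<le> 1 / \<alpha>" using b by (simp add: field_simps power2_eq_square)
  moreover have "\<alpha> - 1 \<le> 1 / (2 - \<alpha>)"
  proof -
    have "0 \<le> (\<alpha> - 3 / 2)\<^sup>2" by simp
    then show ?thesis using b by (simp add: field_simps power2_eq_square)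
  qed
  ultimately have "\<not> 1 / \<alpha> < z" "\<not> 1 / (2 - \<alpha>) \<le> z" using assms by linarith+
  then show ?thesis by (simp add: pushed_density_def)
qed

lemma pushed_density_nonneg: "0 \<le> pushed_density z"
  using pushed_density_eq[of z] pushed_density_eq_0[of z] inv_density_nonneg
  by (cases "0 < z") auto

text \<open>Past \<open>\<alpha> + 1\<close> both branches are active, the terms
  \<open>1 / z\<close> cancel, and \<open>z + big_golden = z + 2 - \<beta>\<close>.\<close>

lemma pushed_density_telescopes:
  assumes "\<alpha> + 1 < z"
  shows "pushed_density z = (1 / (z - \<beta>) + tail (z - 2)) - (1 / (z + 2 - \<beta>) + tail z)"
proof -
  note b = alpha_bounds[OF \<alpha>]
  have "1 / \<alpha> \<le> \<alpha> + 1" "1 / (2 - \<alpha>) \<le> \<alpha> + 1"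
    using b by (auto simp: field_simps power2_eq_square)
  moreover have "z + big_golden = z + 2 - \<beta>" by simp
  ultimately show ?thesis using assms unfolding pushed_density_def by auto
qed

text \<open>The thresholds of the two branches at \<open>t + 1\<close> become the cuts
  \<open>p\<close> and \<open>q\<close> at \<open>t\<close>, and the fibre masses become reciprocals
  of translates of \<open>t\<close>. Thus \<open>inv_density \<alpha> t\<close> heads the
  telescoping series.\<close>

lemma pushed_density_first:
  assumes t: "t \<in> alpha_interval \<alpha>"
  shows "pushed_density (t + 1) = inv_density \<alpha> t - (1 / (t + 3 - \<beta>) + tail (t + 1))"
proof -
  note b = alpha_bounds[OF \<alpha>] big_golden_bounds
  have sq: "big_golden * big_golden = big_golden + 1"
    using big_golden_sq by (simp add: power2_eq_square)
  have t': "\<alpha> - 2 \<le> t" "t < \<alpha>" using t by (auto simp: alpha_interval_def)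
  have p: "1 / \<alpha> < t + 1 \<longleftrightarrow> p < t" by auto
  have "q + 1 = 1 / (2 - \<alpha>)" using b by (simp add: field_simps)
  then have q: "1 / (2 - \<alpha>) \<le> t + 1 \<longleftrightarrow> q \<le> t" by linarith
  \<comment> \<open>This uses \<open>\<beta> * (3 - \<beta>) = 1\<close>; its counterpart for
    \<open>big_golden\<close> uses \<open>big_golden * (1 - \<beta>) = 1\<close>.\<close>
  have k: "fibre_mass \<beta> t = 1 / (t + 3 - \<beta>)"
  proof -
    have "1 + t * \<beta> = \<beta> * (t + 3 - \<beta>)" using sq by (simp add: algebra_simps)
    then show ?thesis using b by (simp add: fibre_mass_def)
  qed
  have kG: "fibre_mass big_golden t = 1 / (t + 1 - \<beta>)"
  proof -
    have "1 + t * big_golden = big_golden * (t + 1 - \<beta>)" using sq by (simp add: algebra_simps)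
    then show ?thesis using b by (simp add: fibre_mass_def)
  qed
  have k1: "fibre_mass 1 t = 1 / (t + 1)" by (simp add: fibre_mass_def add.commute)
  have tail2: "tail (t + 1 - 2) = 0"
  proof (cases "\<alpha> \<le> 1")
    case True
    then have "(1 - \<alpha>) * (t + 1 - 2) \<le> 0" using t' by (intro mult_nonneg_nonpos) auto
    then show ?thesis using True b by (simp add: tail_def)
  next
    case False
    then have "(\<alpha> - 1) * (t + 1 - 2) \<le> (\<alpha> - 1) * (\<alpha> - 1)" using t' by (intro mult_left_mono) auto
    also have "\<dots> \<le> 2 - \<alpha>" using b by (simp add: algebra_simps power2_eq_square)
    finally show ?thesis using False by (simp add: tail_def)
  qed
  \<comment> \<open>The claimed formula subtracts the tail for every \<open>t\<close>, although the
    first branch is inactive here, so the tail must vanish.\<close>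
  have tail0: "tail (t + 1) = 0" if "\<not> p < t"
  proof -
    have le: "(t + 1) * \<alpha> \<le> 1" using that b by (simp add: field_simps)
    show ?thesis
    proof (cases "\<alpha> \<le> 1")
      case True
      have "\<not> \<alpha> \<le> (1 - \<alpha>) * (t + 1)"
      proof
        assume *: "\<alpha> \<le> (1 - \<alpha>) * (t + 1)"
        then have "\<alpha> * \<alpha> \<le> (1 - \<alpha>) * ((t + 1) * \<alpha>)"
          using b mult_right_mono[OF *, of \<alpha>] by (simp add: mult.assoc)
        also have "\<dots> \<le> 1 - \<alpha>" using le True mult_left_mono[OF le, of "1 - \<alpha>"] by simp
        finally have eq: "\<alpha> * \<alpha> = 1 - \<alpha>" using b by (simp add: power2_eq_square)
        \<comment> \<open>Equality forces \<open>\<alpha> = small_golden\<close>; this borderline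
          case is excluded by the strict bound \<open>t < \<alpha>\<close>.\<close>
        have "(1 - \<alpha>) * (t + 1) < (1 - \<alpha>) * (\<alpha> + 1)"
        proof (rule mult_strict_left_mono)
          have "\<alpha> \<noteq> 1" using eq by auto
          then show "0 < 1 - \<alpha>" using True by simp
        qed (use t' in simp)
        also have "\<dots> = \<alpha>" using eq by (simp add: algebra_simps)
        finally show False using * by simp
      qed
      then show ?thesis using True by (simp add: tail_def)
    next
      case False
      have "\<not> 2 - \<alpha> < (\<alpha> - 1) * (t + 1)"
      proof
        assume "2 - \<alpha> < (\<alpha> - 1) * (t + 1)"
        then have "(2 - \<alpha>) * \<alpha> < (\<alpha> - 1) * (t + 1) * \<alpha>" using b by (intro mult_strict_right_mono) auto
        also have "\<dots> = (\<alpha> - 1) * ((t + 1) * \<alpha>)" by simp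
        also have "\<dots> \<le> (\<alpha> - 1) * 1" using le False by (intro mult_left_mono) auto
        finally show False using b by (simp add: algebra_simps power2_eq_square)
      qed
      then show ?thesis using False by (simp add: tail_def)
    qed
  qed
  have G: "t + 1 + big_golden = t + 3 - \<beta>" by simp
  show ?thesis
    using t t' tail0 tail2
    unfolding pushed_density_def inv_density_def p q k kG k1 G
    by (simp add: indicator_def)
qed

text \<open>The series telescopes to its head, as \<open>\<Psi>\<close> tends to 0. Excluding
  \<open>\<alpha> - 2\<close> gives the strict inequality \<open>\<alpha> + 1 < t + 3\<close> for
  the second term.\<close>

lemma pushed_density_sums:
  assumes t: "t \<in> alpha_interval \<alpha>" "t \<noteq> \<alpha> - 2"
  shows "(\<lambda>k. pushed_density (t + 1 + 2 * real k)) sums inv_density \<alpha> t"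
proof -
  note b = alpha_bounds[OF \<alpha>] big_golden_bounds
  have t': "\<alpha> - 2 < t" using t by (simp add: alpha_interval_def)
  define \<Psi> where "\<Psi> z = 1 / (z - \<beta>) + tail (z - 2)" for z
  \<comment> \<open>\<open>f (Suc j)\<close> is \<open>\<Psi>\<close> at
    \<open>t + 1 + 2 * real (Suc j)\<close>; at index 0 that value is replaced by the
    density.\<close>
  define f where "f k = (case k of 0 \<Rightarrow> inv_density \<alpha> t | Suc j \<Rightarrow> \<Psi> (t + 3 + 2 * real j))" for k
  have bound: "\<bar>tail w\<bar> \<le> 1 / w" if "0 < w" for w
  proof -
    have "0 \<le> 1 / (w + \<beta>)" "1 / (w + \<beta>) \<le> 1 / w" "0 \<le> 1 / (w + 1)" "1 / (w + 1) \<le> 1 / w"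
      "0 \<le> 1 / (w + big_golden)" "1 / (w + big_golden) \<le> 1 / w"
      using that beta_bounds by (auto simp: frac_le)
    moreover have "\<bar>u - v\<bar> \<le> 1 / w" if "0 \<le> u" "u \<le> 1 / w" "0 \<le> v" "v \<le> 1 / w" for u v
      using that by linarith
    ultimately show ?thesis using that unfolding tail_def by simp
  qed
  have "(\<lambda>j. \<Psi> (t + 3 + 2 * real (Suc j))) \<longlonglongrightarrow> 0"
  proof (rule Lim_null_comparison)
    show "\<forall>\<^sub>F j in sequentially. norm (\<Psi> (t + 3 + 2 * real (Suc j))) \<le> 2 / real (Suc j)"
    proof (intro always_eventually allI)
      fix j
      let ?z = "t + 3 + 2 * real (Suc j)"
      have z: "real (Suc j) \<le> ?z - 2" "0 < ?z - 2" "?z - 2 \<le> ?z - \<beta>" using t' b by auto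
      then have "\<bar>tail (?z - 2)\<bar> \<le> 1 / (?z - 2)" by (intro bound)
      also have "\<dots> \<le> 1 / real (Suc j)" using z by (intro frac_le) auto
      finally have 1: "\<bar>tail (?z - 2)\<bar> \<le> 1 / real (Suc j)" .
      have 2: "0 \<le> 1 / (?z - \<beta>)" "1 / (?z - \<beta>) \<le> 1 / real (Suc j)"
        using z by (auto intro!: frac_le simp del: of_nat_Suc)
      have "2 / real (Suc j) = 1 / real (Suc j) + 1 / real (Suc j)" by simp
      then show "norm (\<Psi> ?z) \<le> 2 / real (Suc j)"
        using 1 2 unfolding \<Psi>_def real_norm_def by linarith
    qed
    have "(\<lambda>j. 2 * (1 / real (Suc j))) \<longlonglongrightarrow> 2 * 0"
      by (intro tendsto_mult tendsto_const LIMSEQ_Suc lim_const_over_n)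
    then show "(\<lambda>j. 2 / real (Suc j)) \<longlonglongrightarrow> 0" by simp
  qed
  then have "(\<lambda>k. f (Suc (Suc k))) \<longlonglongrightarrow> 0" by (simp add: f_def)
  then have "f \<longlonglongrightarrow> 0"
    by (subst (asm) filterlim_sequentially_Suc, subst (asm) filterlim_sequentially_Suc)
  then have "(\<lambda>k. f k - f (Suc k)) sums (f 0 - 0)" by (rule telescope_sums')
  moreover have "f k - f (Suc k) = pushed_density (t + 1 + 2 * real k)" for k
  proof (cases k)
    case 0
    then show ?thesis using pushed_density_first[OF t(1)] by (simp add: f_def \<Psi>_def algebra_simps)
  next
    case (Suc j)
    have "pushed_density (t + 3 + 2 * real j) = \<Psi> (t + 3 + 2 * real j) - \<Psi> (t + 3 + 2 * real (Suc j))"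
      using t' pushed_density_telescopes[of "t + 3 + 2 * real j"] by (simp add: \<Psi>_def algebra_simps)
    then show ?thesis by (simp add: Suc f_def algebra_simps)
  qed
  ultimately show ?thesis by (simp add: f_def)
qed

text \<open>Both signs of \<open>x\<close> are pulled back to \<open>z = 1 / \<bar>x\<bar>\<close>,
  where the map depends on \<open>z\<close> modulo 2 only. Unfolding the half-line into periods
  leaves the series that sums to the density.\<close>

lemma nn_integral_inv_density_odd_map:
  assumes [measurable]: "E \<in> sets borel" and E: "E \<subseteq> alpha_interval \<alpha>"
  shows "(\<integral>\<^sup>+x. ennreal (inv_density \<alpha> x) * indicator E (odd_map \<alpha> x) \<partial>lborel)
    = (\<integral>\<^sup>+x. ennreal (inv_density \<alpha> x) * indicator E x \<partial>lborel)"
proof -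
  define F where "F x = ennreal (inv_density \<alpha> x) * indicator E (odd_map \<alpha> x)" for x
  have F_meas [measurable]: "F \<in> borel_measurable borel"
    unfolding F_def by (measurable; simp)
  have "(\<integral>\<^sup>+x. F x \<partial>lborel)
      = (\<integral>\<^sup>+x. F x * indicator {0<..} x + F x * indicator {..<0} x \<partial>lborel)"
    using AE_lborel_singleton[of 0] by (intro nn_integral_cong_AE) (auto simp: indicator_def)
  also have "\<dots> = (\<integral>\<^sup>+x. F x * indicator {0<..} x \<partial>lborel) + (\<integral>\<^sup>+x. F x * indicator {..<0} x \<partial>lborel)"
    by (simp add: nn_integral_add)
  also have "(\<integral>\<^sup>+x. F x * indicator {..<0} x \<partial>lborel) = (\<integral>\<^sup>+x. F (- x) * indicator {0<..} x \<partial>lborel)"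
    by (subst nn_integral_real_affine[of _ "-1" 0]) (auto simp: indicator_def intro!: nn_integral_cong)
  also have "(\<integral>\<^sup>+x. F x * indicator {0<..} x \<partial>lborel) + \<dots>
      = (\<integral>\<^sup>+z. F (1 / z) * ennreal (1 / z\<^sup>2) * indicator {0<..} z \<partial>lborel)
        + (\<integral>\<^sup>+z. F (- (1 / z)) * ennreal (1 / z\<^sup>2) * indicator {0<..} z \<partial>lborel)"
    using nn_integral_reciprocal[of F] nn_integral_reciprocal[of "\<lambda>x. F (- x)"] by simp
  also have "\<dots> = (\<integral>\<^sup>+z. F (1 / z) * ennreal (1 / z\<^sup>2) * indicator {0<..} z
        + F (- (1 / z)) * ennreal (1 / z\<^sup>2) * indicator {0<..} z \<partial>lborel)"
    by (simp add: nn_integral_add)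
  also have "\<dots> = (\<integral>\<^sup>+z. ennreal (pushed_density z) * indicator E (reduce \<alpha> (z + 1))
        * indicator {\<alpha> - 1..} z \<partial>lborel)"
  proof (rule nn_integral_cong)
    fix z
    show "F (1 / z) * ennreal (1 / z\<^sup>2) * indicator {0<..} z
        + F (- (1 / z)) * ennreal (1 / z\<^sup>2) * indicator {0<..} z
      = ennreal (pushed_density z) * indicator E (reduce \<alpha> (z + 1)) * indicator {\<alpha> - 1..} z"
    proof (cases "0 < z")
      case True
      then have odd: "odd_map \<alpha> (1 / z) = reduce \<alpha> (z + 1)" "odd_map \<alpha> (- (1 / z)) = reduce \<alpha> (z + 1)"
        by (simp_all add: odd_map_eq_reduce)
      have "ennreal (inv_density \<alpha> (1 / z)) * ennreal (1 / z\<^sup>2)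
          + ennreal (inv_density \<alpha> (- (1 / z))) * ennreal (1 / z\<^sup>2) = ennreal (pushed_density z)"
        using inv_density_nonneg pushed_density_eq[OF True]
        by (simp add: ennreal_mult[symmetric] ennreal_plus[symmetric] add_divide_distrib del: ennreal_plus)
      moreover have "z \<in> {\<alpha> - 1..} \<or> pushed_density z = 0" using pushed_density_eq_0[of z] by force
      ultimately show ?thesis using True
        by (cases "reduce \<alpha> (z + 1) \<in> E") (auto simp: F_def odd)
    qed (use pushed_density_eq_0[of z] in auto)
  qed
  also have "\<dots> = (\<integral>\<^sup>+t. (\<Sum>k. ennreal (pushed_density (t + 2 * real k)) * indicator E (reduce \<alpha> (t + 2 * real k + 1)))
        * indicator {\<alpha> - 1..<\<alpha> - 1 + 2} t \<partial>lborel)"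
    by (rule nn_integral_atLeast_periods) (measurable; simp)
  \<comment> \<open>The map reduces \<open>z + 1\<close>, so a shift by 1 turns the period starting
    at \<open>\<alpha> - 1\<close> into \<open>alpha_interval \<alpha>\<close>.\<close>
  also have "\<dots> = (\<integral>\<^sup>+t. (\<Sum>k. ennreal (pushed_density (1 + 1 * t + 2 * real k))
          * indicator E (reduce \<alpha> (1 + 1 * t + 2 * real k + 1)))
        * indicator {\<alpha> - 1..<\<alpha> - 1 + 2} (1 + 1 * t) \<partial>lborel)"
    by (subst nn_integral_real_affine[of _ 1 1]) simp_all
  also have "\<dots> = (\<integral>\<^sup>+x. ennreal (inv_density \<alpha> x) * indicator E x \<partial>lborel)"
  proof (rule nn_integral_cong_AE)
    show "AE t in lborel. (\<Sum>k. ennreal (pushed_density (1 + 1 * t + 2 * real k))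
          * indicator E (reduce \<alpha> (1 + 1 * t + 2 * real k + 1))) * indicator {\<alpha> - 1..<\<alpha> - 1 + 2} (1 + 1 * t)
        = ennreal (inv_density \<alpha> t) * indicator E t"
      using AE_lborel_singleton[of "\<alpha> - 2"]
    proof eventually_elim
      case (elim t)
      show ?case
      proof (cases "t \<in> alpha_interval \<alpha>")
        case True
        have "reduce \<alpha> (1 + 1 * t + 2 * real k + 1) = t" for k
          using reduce_shift[of \<alpha> t "int k + 1"] reduce_id[OF True] by (simp add: algebra_simps)
        moreover have "(\<Sum>k. ennreal (pushed_density (1 + 1 * t + 2 * real k))) = ennreal (inv_density \<alpha> t)"
          using pushed_density_sums[OF True elim] pushed_density_nonneg
          by (intro suminf_ennreal_eq) (auto simp: add.commute)
        ultimately show ?thesis using True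
          by (simp add: alpha_interval_def)
      next
        case False
        then have "t \<notin> E" using E by auto
        then show ?thesis using False by (auto simp: alpha_interval_def indicator_def)
      qed
    qed
  qed
  finally show ?thesis by (simp add: F_def)
qed

section \<open>Invariance, total mass and ergodicity\<close>

lemma measure_preserving_odd_map: "measure_preserving (alpha_measure \<alpha>) (odd_map \<alpha>)"
  unfolding measure_preserving_def
proof (intro conjI ballI)
  have [measurable]: "alpha_interval \<alpha> \<in> sets borel" by (simp add: alpha_interval_def)
  have "odd_map \<alpha> \<in> measurable (restrict_space borel (alpha_interval \<alpha>)) (restrict_space borel (alpha_interval \<alpha>))"
    using odd_map_in_alpha_interval by (intro measurable_restrict_space2 measurable_restrict_space1) auto
  then show "odd_map \<alpha> \<in> measurable (alpha_measure \<alpha>) (alpha_measure \<alpha>)"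
    by (simp add: measurable_cong_sets[OF sets_alpha_measure sets_alpha_measure])
  fix A assume "A \<in> sets (alpha_measure \<alpha>)"
  then have A: "A \<in> sets borel" "A \<subseteq> alpha_interval \<alpha>"
    by (auto simp: sets_alpha_measure sets_restrict_space_iff)
  note [measurable] = A(1)
  let ?B = "odd_map \<alpha> -` A \<inter> space (alpha_measure \<alpha>)"
  have "odd_map \<alpha> -` A \<inter> space borel \<in> sets borel" using A(1) by measurable
  then have B: "?B \<in> sets borel" "?B \<subseteq> alpha_interval \<alpha>" by (auto simp: space_alpha_measure)
  have "(\<integral>\<^sup>+x. ennreal (inv_density \<alpha> x) * indicator ?B x \<partial>lborel)
      = (\<integral>\<^sup>+x. ennreal (inv_density \<alpha> x) * indicator A (odd_map \<alpha> x) \<partial>lborel)"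
    using inv_density_outside by (intro nn_integral_cong) (auto simp: indicator_def space_alpha_measure)
  then show "emeasure (alpha_measure \<alpha>) ?B = emeasure (alpha_measure \<alpha>) A"
    using nn_integral_inv_density_odd_map[OF A] by (simp only: emeasure_alpha_measure[OF A] emeasure_alpha_measure[OF B])
qed

lemma emeasure_alpha_measure_space: "emeasure (alpha_measure \<alpha>) (alpha_interval \<alpha>) = 1"
proof -
  have "(\<integral>\<^sup>+x. ennreal (inv_density \<alpha> x) * indicator (alpha_interval \<alpha>) x \<partial>lborel)
      = (\<integral>\<^sup>+x. inv_density \<alpha> x \<partial>lborel)"
    using inv_density_outside by (intro nn_integral_cong) (auto simp: indicator_def)
  moreover have "alpha_interval \<alpha> \<in> sets borel" by (simp add: alpha_interval_def)
  moreover have "0 < ln big_golden" using big_golden_bounds by simp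
  ultimately show ?thesis
    using emeasure_alpha_measure[of "alpha_interval \<alpha>"]
    by (simp add: nn_integral_inv_density ennreal_mult[symmetric])
qed

lemma invariant_set_null_or_conull:
  assumes A: "A \<in> sets borel" "A \<subseteq> alpha_interval \<alpha>"
    and inv: "odd_map \<alpha> -` A \<inter> alpha_interval \<alpha> = A"
  shows "A \<in> null_sets lborel \<or> alpha_interval \<alpha> - A \<in> null_sets lborel"
proof -
  note [measurable] = A(1)
  define S where "S = {z. reduce \<alpha> z \<in> A}"
  have S: "S \<in> sets borel" unfolding S_def by measurable
  have per: "x + 2 \<in> S \<longleftrightarrow> x \<in> S" for x
    using reduce_shift[of \<alpha> x 1] by (simp add: S_def)
  \<comment> \<open>Membership in the interval is essential: only there does \<open>reduce\<close>
    fix \<open>x\<close>, so that invariance of \<open>A\<close> applies to \<open>x\<close>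
    itself.\<close>
  have K: "x \<in> S \<longleftrightarrow> 1 / \<bar>x\<bar> + 1 \<in> S" if "x \<in> alpha_interval \<alpha>" "x \<noteq> 0" for x
    using that inv by (auto simp: S_def reduce_id odd_map_eq_reduce[symmetric])
  note unit = reflection_on_unit_interval[of \<alpha> S, OF \<alpha> per K]
  have refl: "- x \<in> S \<longleftrightarrow> x \<in> S" if "x \<notin> \<rat>" for x
    by (rule reflection_invariant[of S, OF per _ that]) (use unit in blast)
  have "x \<in> S \<longleftrightarrow> 1 / x + 1 \<in> S" if "x \<notin> \<rat>" for x
    by (rule inversion_invariant[of S, OF per refl _ that]) (use unit in blast)+
  then have "S \<in> null_sets lborel \<or> - S \<in> null_sets lborel"
    using S per by (intro null_or_conull)
  moreover have "A = S \<inter> alpha_interval \<alpha>" "alpha_interval \<alpha> - A = - S \<inter> alpha_interval \<alpha>"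
    using A reduce_id by (auto simp: S_def)
  moreover have "alpha_interval \<alpha> \<in> sets lborel" by (simp add: alpha_interval_def)
  ultimately show ?thesis by (metis null_set_Int2 Int_commute)
qed

lemma emeasure_alpha_measure_null:
  assumes "E \<in> null_sets lborel" "E \<subseteq> alpha_interval \<alpha>"
  shows "emeasure (alpha_measure \<alpha>) E = 0"
proof -
  have "(\<integral>\<^sup>+x. ennreal (inv_density \<alpha> x) * indicator E x \<partial>lborel) = (\<integral>\<^sup>+x. 0 \<partial>(lborel :: real measure))"
    using AE_not_in[OF assms(1)] by (intro nn_integral_cong_AE) (auto simp: indicator_def)
  then show ?thesis using assms emeasure_alpha_measure[of E] by (auto simp: null_sets_def)
qed

end

theorem proposition15:
  fixes \<alpha> :: real
  assumes "\<alpha> \<in> {small_golden..big_golden}"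
  shows "ergodic_system (alpha_measure \<alpha>) (odd_map \<alpha>)"
proof -
  interpret odd_expansion_parameter \<alpha> by unfold_locales (rule assms)
  show ?thesis
    unfolding ergodic_system_def space_alpha_measure
  proof (intro conjI ballI impI measure_preserving_odd_map emeasure_alpha_measure_space)
    fix A assume A: "A \<in> sets (alpha_measure \<alpha>)" "odd_map \<alpha> -` A \<inter> alpha_interval \<alpha> = A"
    have "alpha_interval \<alpha> \<in> sets borel" by (simp add: alpha_interval_def)
    then have A': "A \<in> sets borel" "A \<subseteq> alpha_interval \<alpha>"
      using A(1) by (auto simp: sets_alpha_measure sets_restrict_space_iff)
    then consider "A \<in> null_sets lborel" | "alpha_interval \<alpha> - A \<in> null_sets lborel"
      using invariant_set_null_or_conull A(2) by blast
    then show "emeasure (alpha_measure \<alpha>) A = 0 \<or> emeasure (alpha_measure \<alpha>) A = 1"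
    proof cases
      case 1
      then show ?thesis using A' emeasure_alpha_measure_null by blast
    next
      case 2
      have "alpha_interval \<alpha> \<in> sets (alpha_measure \<alpha>)"
        using sets.top[of "alpha_measure \<alpha>"] by (simp add: space_alpha_measure)
      then have "emeasure (alpha_measure \<alpha>) (alpha_interval \<alpha>)
          = emeasure (alpha_measure \<alpha>) A + emeasure (alpha_measure \<alpha>) (alpha_interval \<alpha> - A)"
        using A(1) A'(2) by (subst plus_emeasure) (auto intro!: arg_cong[where f = "emeasure (alpha_measure \<alpha>)"])
      then show ?thesis
        using 2 emeasure_alpha_measure_null[of "alpha_interval \<alpha> - A"]
        by (simp add: emeasure_alpha_measure_space)
    qed
  qed
qed

end
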